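(* Let $q\ge 1$, let $U\subset\mathbb{R}^q$ be an open box, $V\subset\mathbb{R}$ an open interval, and let $y:U\to V$ and $g:U\times V\to\mathbb{R}$ satisfy $g(\mathbf{x},y(\mathbf{x}))=0$ and $\frac{\partial g}{\partial y}(\mathbf{x},y(\mathbf{x}))\neq 0$ for all $\mathbf{x}\in U$. Let $\mathbf{n}\in\mathbb{N}^q$ be nonzero and let $y$ and $g$ be sufficiently smooth (say, of class $C^{|\mathbf{n}|}$). Then for any $\mathbf{x}\in U$, $$\frac{y_{\mathbf{n}}(\mathbf{x})}{\mathbf{n}!}=\sum_{\substack{p\,\vdash\,(\mathbf{n},|p|-1)\\(\mathbf{0},1)\notin p}}\frac{1}{|p|}\binom{|p|}{\ldots,\mu_{p;\mathbf{s},t},\ldots}\prod_{(\mathbf{s},t)\in p}\left(-\frac{1}{\mathbf{s}!\,t!}\,\frac{g_{\mathbf{s},t}(\mathbf{x},y(\mathbf{x}))}{g_{\mathbf{0},1}(\mathbf{x},y(\mathbf{x}))}\right),$$ where the sum is over all $(q+1)$-dimensional partitions $p$ of $(\mathbf{n},|p|-1)$ not containing $(\mathbf{0},1)$, and the product contains $\mu_{p;\mathbf{s},t}$ copies of the factor for every distinct element $(\mathbf{s},t)$ of the multiset $p$.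
   Context: $\mathbb{N}=\{0,1,2,\ldots\}$. For $\mathbf{n}=(n_1,\ldots,n_q)\in\mathbb{N}^q$: $|\mathbf{n}|=n_1+\cdots+n_q$ and $\mathbf{n}!=n_1!\cdots n_q!$. Derivatives: $y_{\mathbf{n}}(\mathbf{x})=\frac{\partial^{|\mathbf{n}|}y}{\partial\mathbf{x}^{\mathbf{n}}}(\mathbf{x})$ and, for $(\mathbf{s},t)\in\mathbb{N}^q\times\mathbb{N}$, $g_{\mathbf{s},t}(\mathbf{x},y(\mathbf{x}))=\frac{\partial^{|\mathbf{s}|+t}g}{\partial\mathbf{x}^{\mathbf{s}}\partial y^t}(\mathbf{x},y(\mathbf{x}))$, the partial derivative of $g$ evaluated at the point $(\mathbf{x},y(\mathbf{x}))$. For a nonzero tuple $(\mathbf{n},m)\in\mathbb{N}^q\times\mathbb{N}$, a $(q+1)$-dimensional partition $p$ of $(\mathbf{n},m)$, written $p\vdash(\mathbf{n},m)$, is a finite multiset $\{(\mathbf{s}_1,t_1),\ldots,(\mathbf{s}_r,t_r)\}$ of nonzero tuples in $\mathbb{N}^q\times\mathbb{N}$ that sum to $(\mathbf{n},m)$, counting multiplicities. $|p|=r$ is the number of elements of $p$ counted with multiplicity, and $\mu_{p;\mathbf{s},t}$ is the multiplicity of $(\mathbf{s},t)$ in $p$. If $(\mathbf{s}_1,t_1),\ldots,(\mathbf{s}_l,t_l)$ are the distinct elements of $p$, then $$\binom{|p|}{\ldots,\mu_{p;\mathbf{s},t},\ldots}:=\frac{|p|!}{\mu_{p;\mathbf{s}_1,t_1}!\cdots\mu_{p;\mathbf{s}_l,t_l}!}.$$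 For given $\mathbf{n}$, only finitely many multisets $p$ satisfy $p\vdash(\mathbf{n},|p|-1)$ and $(\mathbf{0},1)\notin p$, so the sum is finite. *)

theory Defs
  imports "HOL-Analysis.Analysis" "HOL-Library.Multiset"
begin

subsection \<open>Partial derivatives\<close>

definition partial_deriv :: "'a::real_normed_vector \<Rightarrow> ('a \<Rightarrow> real) \<Rightarrow> 'a \<Rightarrow> real" where
  "partial_deriv b f x = deriv (\<lambda>h. f (x + h *\<^sub>R b)) 0"

text \<open>Class $C^k$ on an open set: all partial derivatives of order at most \<open>k\<close> (in any order of
  differentiation) exist and are continuous.\<close>

primrec Ck_on :: "nat \<Rightarrow> ('a::euclidean_space \<Rightarrow> real) \<Rightarrow> 'a set \<Rightarrow> bool" where
  "Ck_on 0 f S \<longleftrightarrow> continuous_on S f"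
| "Ck_on (Suc k) f S \<longleftrightarrow> continuous_on S f \<and>
     (\<forall>b\<in>Basis. (\<forall>x\<in>S. (\<lambda>h. f (x + h *\<^sub>R b)) differentiable at 0) \<and>
        Ck_on k (partial_deriv b f) S)"

text \<open>An arbitrary but fixed enumeration of the coordinates, so that iterated partial derivatives
  of arbitrary functions are well defined. For $C^k$ functions on open sets, derivatives of order
  at most \<open>k\<close> do not depend on it.\<close>

definition coords :: "'q::finite list" where
  "coords = (SOME is. distinct is \<and> set is = UNIV)"

definition mixed_deriv ::
  "('q::finite \<Rightarrow> 'a::real_normed_vector) \<Rightarrow> nat^'q \<Rightarrow> ('a \<Rightarrow> real) \<Rightarrow> 'a \<Rightarrow> real" where
  "mixed_deriv e n f = foldr (\<lambda>i. partial_deriv (e i) ^^ (n $ i)) coords f"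

definition x_deriv :: "nat^'q \<Rightarrow> (real^'q \<Rightarrow> real) \<Rightarrow> real^'q \<Rightarrow> real" where
  "x_deriv n f = mixed_deriv (\<lambda>i. axis i 1) n f"

definition xy_deriv ::
  "nat^'q \<Rightarrow> nat \<Rightarrow> ((real^'q) \<times> real \<Rightarrow> real) \<Rightarrow> (real^'q) \<times> real \<Rightarrow> real" where
  "xy_deriv s t g = mixed_deriv (\<lambda>i. (axis i 1, 0)) s ((partial_deriv (0, 1) ^^ t) g)"

subsection \<open>Multi-indices and multidimensional partitions\<close>

definition mi_abs :: "nat^'q \<Rightarrow> nat" where
  "mi_abs n = (\<Sum>i\<in>UNIV. n $ i)"

definition mi_fact :: "nat^'q \<Rightarrow> real" where
  "mi_fact n = (\<Prod>i\<in>UNIV. fact (n $ i))"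

definition mi_partition :: "((nat^'q) \<times> nat) multiset \<Rightarrow> (nat^'q) \<times> nat \<Rightarrow> bool"
    (infix "\<turnstile>" 50) where
  "p \<turnstile> v \<longleftrightarrow> 0 \<notin># p \<and> sum_mset p = v"

definition mset_multinomial :: "'a multiset \<Rightarrow> real" where
  "mset_multinomial p = fact (size p) / (\<Prod>a\<in>set_mset p. fact (count p a))"

lemma mi_abs_eq_0_iff: "mi_abs s = 0 \<longleftrightarrow> s = 0"
  by (auto simp: mi_abs_def vec_eq_iff)

lemma mi_abs_sum_mset: "mi_abs (fst (sum_mset p)) = (\<Sum>a\<in>#p. mi_abs (fst a))"
  by (induction p) (auto simp: mi_abs_def sum.distrib)

lemma snd_sum_mset: "snd (sum_mset p) = (\<Sum>a\<in>#p. snd a)"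
  by (induction p) auto

lemma finite_mi_abs_le: "finite {s :: nat^'q. mi_abs s \<le> k}"
proof (rule finite_subset)
  show "{s :: nat^'q. mi_abs s \<le> k} \<subseteq> vec_lambda ` (UNIV \<rightarrow>\<^sub>E {..k})"
  proof
    fix s :: "nat^'q"
    assume "s \<in> {s. mi_abs s \<le> k}"
    then have "s $ i \<le> k" for i
      using member_le_sum[of i UNIV "\<lambda>i. s $ i"] by (simp add: mi_abs_def)
    then have "(\<lambda>i. s $ i) \<in> UNIV \<rightarrow>\<^sub>E {..k}" by auto
    then show "s \<in> vec_lambda ` (UNIV \<rightarrow>\<^sub>E {..k})"
      by (metis image_eqI vec_nth_inverse)
  qed
  show "finite (vec_lambda ` (UNIV \<rightarrow>\<^sub>E {..k}) :: (nat^'q) set)"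
    by (intro finite_imageI finite_PiE) auto
qed

text \<open>The index set of the sum is finite. For nonzero \<open>n\<close> it does not contain the empty multiset,
  so the truncated subtraction \<open>size p - 1\<close> is harmless.\<close>

lemma finite_implicit_partitions:
  fixes n :: "nat^'q"
  shows "finite {p. p \<turnstile> (n, size p - 1) \<and> (0, 1) \<notin># p}" (is "finite ?P")
proof -
  define N where "N = 2 * mi_abs n"
  define A where "A = {s :: nat^'q. mi_abs s \<le> N} \<times> {..N}"
  have "?P \<subseteq> mset ` {xs. set xs \<subseteq> A \<and> length xs \<le> N}"
  proof
    fix p assume "p \<in> ?P"
    then have p: "0 \<notin># p" "(0, 1) \<notin># p" "sum_mset p = (n, size p - 1)"
      by (auto simp: mi_partition_def)
    have s: "(\<Sum>a\<in>#p. mi_abs (fst a)) = mi_abs n"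
      using mi_abs_sum_mset[of p] p(3) by simp
    have t: "(\<Sum>a\<in>#p. snd a) = size p - 1"
      using snd_sum_mset[of p] p(3) by simp
    have "2 \<le> 2 * mi_abs (fst a) + snd a" if "a \<in># p" for a
    proof (cases "fst a = 0")
      case True
      then have "snd a \<noteq> 0" "snd a \<noteq> 1"
        using p(1,2) that by (metis prod.collapse zero_prod_def)+
      then show ?thesis by simp
    next
      case False
      then have "mi_abs (fst a) \<noteq> 0" by (simp add: mi_abs_eq_0_iff)
      then show ?thesis by simp
    qed
    then have "(\<Sum>a\<in>#p. 2) \<le> (\<Sum>a\<in>#p. 2 * mi_abs (fst a) + snd a)"
      by (intro sum_mset_mono) auto
    also have "\<dots> = N + (size p - 1)"
      using s t by (simp add: sum_mset.distrib sum_mset_distrib_left[symmetric] N_def)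
    finally have size: "size p \<le> N" by simp
    have "a \<in> A" if a: "a \<in># p" for a
    proof -
      obtain r where "p = add_mset a r" using a by (metis multi_member_split)
      then have "mi_abs (fst a) \<le> mi_abs n" "snd a \<le> size p - 1" using s t by auto
      then show ?thesis using size by (cases a) (auto simp: A_def N_def)
    qed
    moreover obtain xs where "mset xs = p" by (metis ex_mset)
    ultimately show "p \<in> mset ` {xs. set xs \<subseteq> A \<and> length xs \<le> N}"
      using size by auto
  qed
  moreover have "finite A" by (simp add: A_def finite_mi_abs_le)
  ultimately show ?thesis
    using finite_subset[OF _ finite_imageI[OF finite_lists_length_le]] by blast
qed

end

theory Submission
  imports Defs "HOL-Library.Poly_Mapping" "HOL-Combinatorics.Multiset_Permutations"
begin

text \<open>
  Put $a_{s,t}(x) = -g_{s,t}(x, y(x)) / (s!\,t!\,g_{0,1}(x, y(x)))$ and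
  $\varphi = \sum a_{s,t} X^s z^t$, summed over all $(s,t)$ other than $(0,0)$ and $(0,1)$.
  A multinomial expansion turns the right-hand side for the index $n$ into
  $F_n = \sum_{r \ge 1} \frac{1}{r} [X^n z^{r-1}]\, \varphi^r$, which is Lagrange's formula for the
  solution of $z = \varphi(X, z)$. It equals $y_n / n!$ because both sides satisfy the same
  recursion under differentiation along the graph of $y$, namely
  $\partial_i F_n = (n_i + 1) F_{n + e_i}$ for $n \ne 0$, with the same starting values
  $F_{e_i} = a_{e_i,0} = \partial_i y$.

  For the recursion, let $\alpha = a_{e_i,0}$ and $\beta = a_{e_i,1} + 2 a_{0,2} \alpha$. Since
  $\partial_i y = \alpha$ and the logarithmic derivative of $g_{0,1}$ along the graph is $-\beta$,
  the chain rule says that $\varphi$ changes in direction $i$ at the rate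
  $\varphi' = \partial_i \varphi + \alpha (\partial_z \varphi - 1) + \beta (\varphi - z)$.
  Hence $\partial_i F_n = \sum_{r \ge 1} [X^n z^{r-1}]\, \varphi^{r-1} \varphi'$. The first summand
  of $\varphi'$ contributes $(n_i + 1) F_{n + e_i}$. The other two contribute telescoping sums,
  because $\varphi^{r-1} \partial_z \varphi = \frac{1}{r} \partial_z \varphi^r$; only $-\alpha$ is left
  of them, and only when $n = 0$. As $F_0 = 0$, the case $n = 0$ yields the starting value. This
  identity is \<open>lagrange_sum_graph_derivative\<close>.

  All sums are finite because with the weight $2|s| + t$ every monomial of $\varphi$ has weight at
  least 2. Since $y$ and $g$ are only of class $C^{|n|}$, $\varphi$ is truncated at total degree
  $|n|$, and only those coefficients of $\varphi^r$ are differentiated that involve derivatives of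
  $g$ of order less than $|n|$ (\<open>has_coeff_deriv\<close>). On the analytic side one needs the symmetry
  of mixed partial derivatives (\<open>partial_deriv_commute\<close>) and the chain rule along the graph
  (\<open>partial_chain_rule\<close>).
\<close>

section \<open>Polynomials over a monoid with finite decompositions\<close>

abbreviation "lookup \<equiv> Poly_Mapping.lookup"
abbreviation "single \<equiv> Poly_Mapping.single"

text \<open>The property that makes the Cauchy product a finite sum whose index set does not depend on the factors.
  The fixed index set is what allows products of families of polynomials to be differentiated
  coefficient by coefficient.\<close>

class finite_splits = cancel_comm_monoid_add +
  assumes finite_splits: "finite {(a, b). a + b = v}"

definition splits :: "'m::finite_splits \<Rightarrow> ('m \<times> 'm) set" where
  "splits v = {(a, b). a + b = v}"

lemma finite_splits_set [simp]: "finite (splits v)"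
  unfolding splits_def by (rule finite_splits)

lemma mem_splits [simp]: "(a, b) \<in> splits v \<longleftrightarrow> a + b = v"
  by (simp add: splits_def)

instance nat :: finite_splits
proof
  show "finite {(a, b). a + b = v}" for v :: nat
    by (rule finite_subset[of _ "{..v} \<times> {..v}"]) auto
qed

instance prod :: (finite_splits, finite_splits) finite_splits
proof
  fix v :: "'a \<times> 'b"
  have "{(a, b). a + b = v} \<subseteq>
      (\<lambda>((a, b), (c, d)). ((a, c), (b, d))) ` (splits (fst v) \<times> splits (snd v))"
  proof clarify
    fix a b :: 'a and c d :: 'b
    show "((a, c), (b, d)) \<in> (\<lambda>((a, b), (c, d)). ((a, c), (b, d))) `
        (splits (fst ((a, c) + (b, d))) \<times> splits (snd ((a, c) + (b, d))))"
      by (rule image_eqI[of _ _ "((a, b), (c, d))"]) auto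
  qed
  then show "finite {(a, b). a + b = v}" by (rule finite_subset) simp
qed

instance vec :: (finite_splits, finite) finite_splits
proof
  fix v :: "'a^'b"
  let ?S = "Pi\<^sub>E UNIV (\<lambda>i. splits (v $ i))"
  have "{(a, b). a + b = v} \<subseteq> (\<lambda>f. (\<chi> i. fst (f i), \<chi> i. snd (f i))) ` ?S"
  proof clarify
    fix a b :: "'a^'b"
    show "(a, b) \<in> (\<lambda>f. (\<chi> i. fst (f i), \<chi> i. snd (f i))) ` Pi\<^sub>E UNIV (\<lambda>i. splits ((a + b) $ i))"
      by (rule image_eqI[of _ _ "\<lambda>i. (a $ i, b $ i)"]) auto
  qed
  moreover have "finite ?S" by (rule finite_PiE) auto
  ultimately show "finite {(a, b). a + b = v}" by (meson finite_subset finite_imageI)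
qed

lemma lookup_mult_splits:
  fixes p r :: "'m::finite_splits \<Rightarrow>\<^sub>0 real"
  shows "lookup (p * r) v = (\<Sum>(a, b)\<in>splits v. lookup p a * lookup r b)"
proof -
  have "lookup (p * r) v = prod_fun (lookup p) (lookup r) v"
    by (simp add: times_poly_mapping.rep_eq)
  also have "\<dots> = (\<Sum>(a, b). lookup p a * lookup r b when v = a + b)"
    by (rule prod_fun_unfold_prod) auto
  also have "\<dots> = (\<Sum>(a, b)\<in>splits v. lookup p a * lookup r b when v = a + b)"
    by (rule Sum_any.expand_superset[OF finite_splits_set]) (auto simp: when_def split: if_splits)
  also have "\<dots> = (\<Sum>(a, b)\<in>splits v. lookup p a * lookup r b)"
    by (rule sum.cong) auto
  finally show ?thesis .
qed

lemma lookup_single_mult: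
  fixes p :: "'m::finite_splits \<Rightarrow>\<^sub>0 real"
  shows "lookup (single b c * p) (b + v) = c * lookup p v"
proof -
  have "lookup (single b c * p) (b + v) =
      (\<Sum>(a, d)\<in>splits (b + v). lookup (single b c) a * lookup p d)"
    by (rule lookup_mult_splits)
  also have "\<dots> = (\<Sum>(a, d)\<in>{(b, v)}. lookup (single b c) a * lookup p d)"
    by (rule sum.mono_neutral_right[OF finite_splits_set])
       (auto simp: lookup_single when_def split: if_splits)
  finally show ?thesis by simp
qed

lemma lookup_single_mult_eq_0:
  fixes p :: "'m::finite_splits \<Rightarrow>\<^sub>0 real"
  assumes "\<And>u. v \<noteq> b + u"
  shows "lookup (single b c * p) v = 0"
  unfolding lookup_mult_splits
proof (intro sum.neutral ballI, clarify)
  fix a u assume "(a, u) \<in> splits v"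
  then have "a \<noteq> b" using assms[of u] by auto
  then show "lookup (single b c) a * lookup p u = 0" by (simp add: lookup_single)
qed

lemma lookup_const_mult:
  fixes p :: "'m::finite_splits \<Rightarrow>\<^sub>0 real"
  shows "lookup (single 0 c * p) v = c * lookup p v"
  using lookup_single_mult[of 0 c p v] by simp

definition additive_weight :: "('m::finite_splits \<Rightarrow> nat) \<Rightarrow> bool" where
  "additive_weight w \<longleftrightarrow> (\<forall>u v. w (u + v) = w u + w v)"

lemma lookup_mult_eq_0:
  fixes p r :: "'m::finite_splits \<Rightarrow>\<^sub>0 real"
  assumes "additive_weight w" "\<And>u. w u < c \<Longrightarrow> lookup p u = 0" "\<And>u. w u < d \<Longrightarrow> lookup r u = 0"
    and "w v < c + d"
  shows "lookup (p * r) v = 0"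
  unfolding lookup_mult_splits
proof (intro sum.neutral ballI, clarify)
  fix a b assume "(a, b) \<in> splits v"
  then have "w a + w b < c + d" using assms(1,4) by (auto simp: additive_weight_def)
  then have "w a < c \<or> w b < d" by linarith
  then show "lookup p a * lookup r b = 0" using assms(2,3) by auto
qed

lemma lookup_power_eq_0:
  fixes p :: "'m::finite_splits \<Rightarrow>\<^sub>0 real"
  assumes "additive_weight w" "\<And>u. w u < c \<Longrightarrow> lookup p u = 0" "w v < c * r"
  shows "lookup (p ^ r) v = 0"
  using assms(3)
proof (induction r arbitrary: v)
  case (Suc r)
  then show ?case
    using lookup_mult_eq_0[OF assms(1,2), where r = "p ^ r" and d = "c * r"] by simp
qed simp

text \<open>The Euler operator $\sum c_v X^v \mapsto \sum w(v) c_v X^v$ is a derivation for every additive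
  weight $w$. Working with it rather than with $\partial$ directly makes the Leibniz rule a
  coefficientwise triviality, since no exponents are shifted.\<close>

definition euler :: "('m::finite_splits \<Rightarrow> nat) \<Rightarrow> ('m \<Rightarrow>\<^sub>0 real) \<Rightarrow> ('m \<Rightarrow>\<^sub>0 real)" where
  "euler w p = Poly_Mapping.mapp (\<lambda>v c. real (w v) * c) p"

lemma lookup_euler: "lookup (euler w p) v = real (w v) * lookup p v"
  by (simp add: euler_def lookup_mapp when_def in_keys_iff)

lemma euler_mult:
  assumes "additive_weight w"
  shows "euler w (p * r) = euler w p * r + p * euler w r"
proof (rule poly_mapping_eqI)
  fix v
  show "lookup (euler w (p * r)) v = lookup (euler w p * r + p * euler w r) v"
    unfolding lookup_add lookup_euler lookup_mult_splits sum_distrib_left sum.distrib[symmetric]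
    using assms by (intro sum.cong) (auto simp: additive_weight_def algebra_simps)
qed

lemma euler_power:
  assumes "additive_weight w"
  shows "euler w (p ^ Suc r) = of_nat (Suc r) * (p ^ r * euler w p)"
proof (induction r)
  case (Suc r)
  have "euler w (p ^ Suc (Suc r)) = euler w p * p ^ Suc r + p * euler w (p ^ Suc r)"
    by (subst power_Suc, rule euler_mult[OF assms])
  also have "\<dots> = of_nat (Suc (Suc r)) * (p ^ Suc r * euler w p)"
  proof -
    have "e * (p * q) + p * (c * (q * e)) = (1 + c) * (p * q * e)" for e q c
      by (simp only: ring_distribs ac_simps mult_1_left)
    then show ?thesis unfolding Suc by (simp only: power_Suc of_nat_Suc[of "Suc r"])
  qed
  finally show ?case .
qed simp

text \<open>The partial derivative in the variable $X^b$, where $w(v)$ is the exponent of that variable in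
  $X^v$. It is the Euler operator divided by $X^b$.\<close>

definition poly_partial ::
  "'m::finite_splits \<Rightarrow> ('m \<Rightarrow> nat) \<Rightarrow> ('m \<Rightarrow>\<^sub>0 real) \<Rightarrow> ('m \<Rightarrow>\<^sub>0 real)" where
  "poly_partial b w p = Poly_Mapping.map_key (\<lambda>v. b + v) (euler w p)"

lemma lookup_poly_partial:
  "lookup (poly_partial b w p) v = real (w (b + v)) * lookup p (b + v)"
  by (simp add: poly_partial_def map_key.rep_eq lookup_euler inj_def)

text \<open>This is $p^r \partial p = \frac{1}{r+1} \partial p^{r+1}$. It follows from the Leibniz rule for the
  Euler operator, after multiplication by the variable $X^b$.\<close>

lemma lookup_power_mult_partial:
  fixes p :: "'m::finite_splits \<Rightarrow>\<^sub>0 real"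
  assumes "additive_weight w" "\<And>v. w v \<noteq> 0 \<Longrightarrow> \<exists>u. v = b + u"
  shows "lookup (p ^ r * poly_partial b w p) v =
    real (w (b + v)) * lookup (p ^ Suc r) (b + v) / real (Suc r)"
proof -
  have eq: "single b 1 * poly_partial b w p = euler w p"
  proof (rule poly_mapping_eqI)
    fix v
    show "lookup (single b 1 * poly_partial b w p) v = lookup (euler w p) v"
    proof (cases "\<exists>u. v = b + u")
      case True
      then show ?thesis by (auto simp: lookup_single_mult lookup_poly_partial lookup_euler)
    next
      case False
      then show ?thesis using assms(2)[of v]
        by (auto simp: lookup_single_mult_eq_0 lookup_euler)
    qed
  qed
  have "real (Suc r) * lookup (p ^ r * poly_partial b w p) v =
      real (Suc r) * lookup (single b 1 * (p ^ r * poly_partial b w p)) (b + v)"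
    by (simp add: lookup_single_mult)
  also have "single b 1 * (p ^ r * poly_partial b w p) = p ^ r * euler w p"
    by (simp add: eq[symmetric] ac_simps)
  also have "real (Suc r) * lookup (p ^ r * euler w p) (b + v) =
      lookup (single 0 (real (Suc r)) * (p ^ r * euler w p)) (b + v)"
    by (simp only: lookup_const_mult)
  also have "\<dots> = lookup (euler w (p ^ Suc r)) (b + v)"
    by (simp only: euler_power[OF assms(1)] single_of_nat)
  finally show ?thesis by (simp add: lookup_euler field_simps)
qed

text \<open>A family of polynomials of order at least \<open>m\<close>, with respect to the weight \<open>w\<close>, of which only the
  \<open>k\<close> lowest layers of coefficients are known to be differentiable at 0. Derivatives of higher
  order of $g$ need not exist, so nothing may be claimed about the remaining layers.\<close>

definition has_coeff_deriv ::
  "('m::finite_splits \<Rightarrow> nat) \<Rightarrow> (real \<Rightarrow> 'm \<Rightarrow>\<^sub>0 real) \<Rightarrow> ('m \<Rightarrow>\<^sub>0 real) \<Rightarrow> nat \<Rightarrow> nat \<Rightarrow> bool" where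
  "has_coeff_deriv w \<phi> \<phi>' m k \<longleftrightarrow>
     (\<forall>u. w u < m \<longrightarrow> (\<forall>h. lookup (\<phi> h) u = 0) \<and> lookup \<phi>' u = 0) \<and>
     (\<forall>u. w u < m + k \<longrightarrow> ((\<lambda>h. lookup (\<phi> h) u) has_real_derivative lookup \<phi>' u) (at 0))"

text \<open>The number \<open>k\<close> of differentiable layers survives multiplication: in a coefficient of weight below
  $m + l + k$, a factor whose weight is too large to be controlled is multiplied by one that
  vanishes identically.\<close>

lemma has_coeff_deriv_mult:
  assumes w: "additive_weight w" and "has_coeff_deriv w \<phi> \<phi>' m k" "has_coeff_deriv w \<psi> \<psi>' l k"
  shows "has_coeff_deriv w (\<lambda>h. \<phi> h * \<psi> h) (\<phi>' * \<psi> 0 + \<phi> 0 * \<psi>') (m + l) k"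
proof -
  have vp: "lookup (\<phi> h) u = 0" "lookup \<phi>' u = 0" if "w u < m" for h u
    using assms(2) that by (auto simp: has_coeff_deriv_def)
  have vr: "lookup (\<psi> h) u = 0" "lookup \<psi>' u = 0" if "w u < l" for h u
    using assms(3) that by (auto simp: has_coeff_deriv_def)
  have dv: "((\<lambda>h. lookup (\<phi> h) u) has_real_derivative lookup \<phi>' u) (at 0)" if "w u < m + k" for u
    using assms(2) that by (auto simp: has_coeff_deriv_def)
  have dw: "((\<lambda>h. lookup (\<psi> h) u) has_real_derivative lookup \<psi>' u) (at 0)" if "w u < l + k" for u
    using assms(3) that by (auto simp: has_coeff_deriv_def)
  have "((\<lambda>h. lookup (\<phi> h * \<psi> h) u) has_real_derivative lookup (\<phi>' * \<psi> 0 + \<phi> 0 * \<psi>') u) (at 0)"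
    if u: "w u < m + l + k" for u
    unfolding lookup_add lookup_mult_splits sum.distrib[symmetric]
  proof -
    have "((\<lambda>h. lookup (\<phi> h) a * lookup (\<psi> h) b) has_real_derivative
        lookup \<phi>' a * lookup (\<psi> 0) b + lookup (\<phi> 0) a * lookup \<psi>' b) (at 0)"
      if "(a, b) \<in> splits u" for a b
    proof -
      have s: "w a + w b < m + l + k" using u w that by (auto simp: additive_weight_def)
      consider "w b < l" | "w a < m" | "w a < m + k" "w b < l + k" using s by linarith
      then show ?thesis
      proof cases
        case 3
        then show ?thesis using dv dw by (auto intro!: derivative_eq_intros)
      qed (simp_all add: vp vr)
    qed
    then show "((\<lambda>h. \<Sum>(a, b)\<in>splits u. lookup (\<phi> h) a * lookup (\<psi> h) b) has_real_derivative
       (\<Sum>x\<in>splits u. (case x of (a, b) \<Rightarrow> lookup \<phi>' a * lookup (\<psi> 0) b) +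
          (case x of (a, b) \<Rightarrow> lookup (\<phi> 0) a * lookup \<psi>' b))) (at 0)"
      by (intro DERIV_sum) auto
  qed
  moreover have "lookup (\<phi> h * \<psi> h) u = 0" "lookup (\<phi>' * \<psi> 0 + \<phi> 0 * \<psi>') u = 0"
    if u: "w u < m + l" for u h
    using lookup_mult_eq_0[OF w vp(1) vr(1) u, of h h]
      lookup_mult_eq_0[OF w vp(2) vr(1) u, of 0]
      lookup_mult_eq_0[OF w vp(1) vr(2) u, of 0]
    by (auto simp: lookup_add)
  ultimately show ?thesis
    unfolding has_coeff_deriv_def by blast
qed

lemma has_coeff_deriv_power:
  assumes w: "additive_weight w" and \<phi>: "has_coeff_deriv w \<phi> \<phi>' 1 k"
  shows "has_coeff_deriv w (\<lambda>h. \<phi> h ^ Suc r) (of_nat (Suc r) * (\<phi> 0 ^ r * \<phi>')) (Suc r) k"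
proof (induction r)
  case 0
  then show ?case using \<phi> by simp
next
  case (Suc r)
  have "has_coeff_deriv w (\<lambda>h. \<phi> h * \<phi> h ^ Suc r)
     (\<phi>' * \<phi> 0 ^ Suc r + \<phi> 0 * (of_nat (Suc r) * (\<phi> 0 ^ r * \<phi>'))) (1 + Suc r) k"
    by (rule has_coeff_deriv_mult[OF w \<phi> Suc])
  moreover have "\<phi>' * \<phi> 0 ^ Suc r + \<phi> 0 * (of_nat (Suc r) * (\<phi> 0 ^ r * \<phi>')) =
      of_nat (Suc (Suc r)) * (\<phi> 0 ^ Suc r * \<phi>')"
    by (simp add: algebra_simps)
  ultimately show ?case by (simp only: power_Suc[of _ "Suc r"]) simp
qed


section \<open>Powers of a sum of monomials as sums over multisets\<close>

lemma power_sum_single: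
  fixes a :: "'m::finite_splits \<Rightarrow> real"
  assumes "finite A"
  shows "(\<Sum>u\<in>A. single u (a u)) ^ r =
    (\<Sum>xs | set xs \<subseteq> A \<and> length xs = r. single (sum_list xs) (prod_list (map a xs)))"
proof (induction r)
  case 0
  have "{xs. set xs \<subseteq> A \<and> length xs = 0} = {[]}" by auto
  then show ?case by simp
next
  case (Suc r)
  let ?L = "\<lambda>r. {xs. set xs \<subseteq> A \<and> length xs = r}"
  have L: "?L (Suc r) = (\<lambda>(u, xs). u # xs) ` (A \<times> ?L r)"
    by (auto simp: length_Suc_conv image_iff)
  have "(\<Sum>u\<in>A. single u (a u)) ^ Suc r =
      (\<Sum>(u, xs)\<in>A \<times> ?L r. single (sum_list (u # xs)) (prod_list (map a (u # xs))))"
    by (simp add: Suc sum_product sum.cartesian_product mult_single)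
  also have "\<dots> = (\<Sum>xs\<in>?L (Suc r). single (sum_list xs) (prod_list (map a xs)))"
    unfolding L by (subst sum.reindex) (auto simp: inj_on_def case_prod_unfold)
  finally show ?case .
qed

lemma card_permutations_eq_multinomial:
  "real (card (permutations_of_multiset p)) = mset_multinomial p"
proof -
  have "real (card (permutations_of_multiset p)) * (\<Prod>x\<in>set_mset p. fact (count p x)) = fact (size p)"
    using arg_cong[OF card_permutations_of_multiset_aux[of p], of real] by simp
  then show ?thesis by (simp add: mset_multinomial_def field_simps)
qed

text \<open>Expanding the power gives a sum over lists; the lists with the same underlying multiset contribute
  equally, and their number is the multinomial coefficient.\<close>

lemma lookup_power_sum_single:
  fixes a :: "'m::finite_splits \<Rightarrow> real"
  assumes "finite A"
  shows "lookup ((\<Sum>u\<in>A. single u (a u)) ^ r) v =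
    (\<Sum>p | set_mset p \<subseteq> A \<and> size p = r \<and> sum_mset p = v. mset_multinomial p * (\<Prod>u\<in>#p. a u))"
proof -
  let ?L = "{xs. set xs \<subseteq> A \<and> length xs = r}"
  let ?Lv = "{xs\<in>?L. sum_list xs = v}"
  let ?M = "{p. set_mset p \<subseteq> A \<and> size p = r \<and> sum_mset p = v}"
  have fin: "finite ?L" by (rule finite_lists_length_eq[OF assms])
  have "lookup ((\<Sum>u\<in>A. single u (a u)) ^ r) v = (\<Sum>xs\<in>?L. prod_list (map a xs) when sum_list xs = v)"
    by (simp add: power_sum_single[OF assms] lookup_sum lookup_single)
  also have "\<dots> = (\<Sum>xs\<in>?Lv. prod_list (map a xs))"
    using fin by (intro sum.mono_neutral_cong_right) auto
  also have "\<dots> = (\<Sum>p\<in>mset ` ?Lv. \<Sum>xs\<in>{xs\<in>?Lv. mset xs = p}. prod_list (map a xs))"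
    by (rule sum.image_gen) (rule finite_subset[OF _ fin], auto)
  also have "mset ` ?Lv = ?M"
  proof (intro equalityI subsetI)
    fix p assume "p \<in> ?M"
    moreover obtain xs where "mset xs = p" by (metis ex_mset)
    ultimately have "xs \<in> ?Lv" by (auto simp: sum_mset_sum_list)
    then show "p \<in> mset ` ?Lv" using \<open>mset xs = p\<close> by blast
  qed (auto simp: sum_mset_sum_list)
  also have "(\<Sum>p\<in>?M. \<Sum>xs\<in>{xs\<in>?Lv. mset xs = p}. prod_list (map a xs)) =
      (\<Sum>p\<in>?M. mset_multinomial p * (\<Prod>u\<in>#p. a u))"
  proof (rule sum.cong[OF refl])
    fix p assume p: "p \<in> ?M"
    have "{xs\<in>?Lv. mset xs = p} = permutations_of_multiset p"
      using p by (auto simp: permutations_of_multiset_def sum_mset_sum_list[symmetric])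
    moreover have "prod_list (map a xs) = (\<Prod>u\<in>#p. a u)" if "xs \<in> permutations_of_multiset p" for xs
      using that by (auto simp: permutations_of_multiset_def prod_mset_prod_list[symmetric])
    ultimately show "(\<Sum>xs\<in>{xs\<in>?Lv. mset xs = p}. prod_list (map a xs)) =
        mset_multinomial p * (\<Prod>u\<in>#p. a u)"
      by (simp add: card_permutations_eq_multinomial[symmetric])
  qed
  finally show ?thesis .
qed

section \<open>The Lagrange sum and its derivative\<close>

text \<open>Exponents $(s,t)$ of the monomials $X^s z^t$.\<close>

type_synonym 'q index = "(nat^'q) \<times> nat"

definition total_degree :: "'q::finite index \<Rightarrow> nat" where
  "total_degree u = mi_abs (fst u) + snd u"

lemma mi_abs_add: "mi_abs (m + n) = mi_abs m + mi_abs n"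
  by (simp add: mi_abs_def sum.distrib)

lemma mi_abs_axis [simp]: "mi_abs (axis i 1) = 1"
  by (simp add: mi_abs_def axis_def)

lemma mi_abs_0 [simp]: "mi_abs 0 = 0"
  by (simp add: mi_abs_eq_0_iff)

lemma total_degree_eq_0_iff: "total_degree u = 0 \<longleftrightarrow> u = 0"
  by (cases u) (auto simp: total_degree_def mi_abs_eq_0_iff zero_prod_def)

lemma finite_total_degree_le: "finite {u :: 'q::finite index. total_degree u \<le> k}"
  by (rule finite_subset[of _ "{s. mi_abs s \<le> k} \<times> {..k}"])
     (auto simp: total_degree_def finite_mi_abs_le)

text \<open>If \<open>\<alpha>\<close> is the slope of $y$ in direction \<open>i\<close> and $-\beta$ the logarithmic derivative of $g_{0,1}$,
  this is the rate of change of the normalized Taylor series at a point that moves along the graph in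
  that direction. Subtracting 1 and $z$ removes the two monomials that $\varphi$ does not contain.\<close>

definition graph_derivative ::
  "'q::finite \<Rightarrow> real \<Rightarrow> real \<Rightarrow> ('q index \<Rightarrow>\<^sub>0 real) \<Rightarrow> ('q index \<Rightarrow>\<^sub>0 real)" where
  "graph_derivative i \<alpha> \<beta> \<phi> = poly_partial (axis i 1, 0) (\<lambda>v. fst v $ i) \<phi>
     + single 0 \<alpha> * (poly_partial (0, 1) snd \<phi> - 1)
     + single 0 \<beta> * (\<phi> - single (0, 1) 1)"

text \<open>Lagrange's formula $\sum_{r \ge 1} \frac{1}{r} [X^n z^{r-1}]\, \varphi^r$, cut off after \<open>R\<close> terms
  and with \<open>r\<close> shifted by one.\<close>

definition lagrange_sum :: "nat \<Rightarrow> nat^'q::finite \<Rightarrow> ('q index \<Rightarrow>\<^sub>0 real) \<Rightarrow> real" where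
  "lagrange_sum R n \<phi> = (\<Sum>r<R. lookup (\<phi> ^ Suc r) (n, r) / real (Suc r))"

text \<open>With this weight every monomial other than 1 and $z$ weighs at least 2, whereas $X^n z^k$ weighs
  only $2|n| + k$. This makes $[X^n z^k]\, \varphi^r$ vanish whenever $r$ exceeds $|n| + k/2$.\<close>

definition weight :: "'q::finite index \<Rightarrow> nat" where
  "weight u = 2 * mi_abs (fst u) + snd u"

lemma additive_weights: "additive_weight total_degree" "additive_weight weight" "additive_weight (\<lambda>v. fst v $ i)" "additive_weight snd"
  by (simp_all add: additive_weight_def total_degree_def weight_def mi_abs_add)

lemma weight_less_2:
  assumes "weight u < 2" shows "u = 0 \<or> u = (0, 1)"
proof -
  obtain s t where u: "u = (s, t)" by (cases u)
  have "mi_abs s = 0" using assms by (simp add: weight_def u)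
  then show ?thesis using assms by (auto simp: weight_def u mi_abs_eq_0_iff zero_prod_def)
qed

lemma axis_add_cases:
  fixes n :: "nat^'q::finite"
  assumes "n $ i \<noteq> 0" shows "\<exists>m. n = axis i 1 + m"
  by (rule exI[of _ "\<chi> j. n $ j - axis i 1 $ j"]) (use assms in \<open>auto simp: vec_eq_iff axis_def\<close>)

text \<open>The heart of the proof. The \<open>\<alpha>\<close>-part and the \<open>\<beta>\<close>-part telescope in \<open>r\<close>; their upper ends vanish
  by the weight bound, and the lower ends vanish except for $[X^n]\, \varphi^0$, which is 1 if
  $n = 0$.\<close>

theorem lagrange_sum_graph_derivative:
  fixes \<phi> :: "'q::finite index \<Rightarrow>\<^sub>0 real"
  assumes 0: "lookup \<phi> 0 = 0" and 1: "lookup \<phi> (0, 1) = 0" and R: "2 * mi_abs n < R"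
  shows "(\<Sum>r<R. lookup (\<phi> ^ r * graph_derivative i \<alpha> \<beta> \<phi>) (n, r)) =
    real (n $ i + 1) * lagrange_sum R (axis i 1 + n) \<phi> - (if n = 0 then \<alpha> else 0)"
proof -
  have van: "lookup (\<phi> ^ r) (m, k) = 0" if "2 * mi_abs m + k < 2 * r" for r m k
  proof (rule lookup_power_eq_0[OF additive_weights(2), of 2])
    show "lookup \<phi> u = 0" if "weight u < 2" for u
      using weight_less_2[OF that] 0 1 by auto
  qed (use that in \<open>simp add: weight_def\<close>)
  have x: "lookup (\<phi> ^ r * poly_partial (axis i 1, 0) (\<lambda>v. fst v $ i) \<phi>) (n, r) =
      real (n $ i + 1) * (lookup (\<phi> ^ Suc r) (axis i 1 + n, r) / real (Suc r))" for r
  proof (subst lookup_power_mult_partial[OF additive_weights(3)])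
    show "\<exists>u. v = (axis i 1, 0) + u" if "fst v $ i \<noteq> 0" for v :: "'q index"
      using axis_add_cases[OF that] by (cases v) auto
  qed (simp add: axis_def)
  have z: "lookup (\<phi> ^ r * poly_partial (0, 1) snd \<phi>) (n, r) = lookup (\<phi> ^ Suc r) (n, Suc r)" for r
  proof (subst lookup_power_mult_partial[OF additive_weights(4)])
    show "\<exists>u. v = (0, 1) + u" if "snd v \<noteq> 0" for v :: "'q index"
      using that by (intro exI[of _ "(fst v, snd v - 1)"]) (cases v, auto)
  qed simp
  \<comment> \<open>The term $[X^n z^{r-1}]\, \varphi^r$ of the second telescoping sum, which is 0 at $r = 0$.\<close>
  define G where "G r = (case r of 0 \<Rightarrow> 0 | Suc k \<Rightarrow> lookup (\<phi> ^ r) (n, k))" for r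
  have zz: "lookup (\<phi> ^ r * single (0, 1) 1) (n, r) = G r" for r
  proof (cases r)
    case 0
    then show ?thesis by (simp add: G_def lookup_single when_def)
  next
    case (Suc k)
    then show ?thesis
      using lookup_single_mult[of "(0,1)" 1 "\<phi> ^ r" "(n, k)"] by (simp add: G_def mult.commute)
  qed
  have step: "lookup (\<phi> ^ r * graph_derivative i \<alpha> \<beta> \<phi>) (n, r) =
      real (n $ i + 1) * (lookup (\<phi> ^ Suc r) (axis i 1 + n, r) / real (Suc r))
      + \<alpha> * (lookup (\<phi> ^ Suc r) (n, Suc r) - lookup (\<phi> ^ r) (n, r))
      + \<beta> * (G (Suc r) - G r)" for r
  proof -
    have "\<phi> ^ r * graph_derivative i \<alpha> \<beta> \<phi> = \<phi> ^ r * poly_partial (axis i 1, 0) (\<lambda>v. fst v $ i) \<phi>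
       + single 0 \<alpha> * (\<phi> ^ r * poly_partial (0, 1) snd \<phi> - \<phi> ^ r)
       + single 0 \<beta> * (\<phi> ^ Suc r - \<phi> ^ r * single (0, 1) 1)"
      by (simp add: graph_derivative_def algebra_simps)
    then show ?thesis
      by (simp only: lookup_add lookup_minus lookup_const_mult x z zz) (simp add: G_def)
  qed
  have "lookup (\<phi> ^ R) (n, R) = 0" by (rule van) (use R in simp)
  moreover have "G R = 0" using R by (cases R) (auto simp: G_def intro!: van simp del: power_Suc)
  moreover have "G 0 = 0" by (simp add: G_def)
  moreover have "(\<Sum>r<R. lookup (\<phi> ^ Suc r) (n, Suc r) - lookup (\<phi> ^ r) (n, r)) =
      lookup (\<phi> ^ R) (n, R) - lookup (\<phi> ^ 0) (n, 0)"
    by (rule sum_lessThan_telescope)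
  moreover have "(\<Sum>r<R. G (Suc r) - G r) = G R - G 0"
    by (rule sum_lessThan_telescope)
  ultimately show ?thesis
    unfolding step sum.distrib sum_distrib_left[symmetric] lagrange_sum_def
    by (auto simp: lookup_one zero_prod_def simp del: power_Suc)
qed

text \<open>Differentiation of $\frac{1}{r+1} \varphi^{r+1}$ cancels the denominator. The exponent $(n, r)$ has
  total degree $|n| + r$, so it lies within the $|n|$ lowest layers of a power of order $r + 1$.\<close>

lemma lagrange_sum_has_deriv:
  assumes "has_coeff_deriv total_degree \<phi> \<phi>' 1 (mi_abs n)"
  shows "((\<lambda>h. lagrange_sum R n (\<phi> h)) has_real_derivative
    (\<Sum>r<R. lookup (\<phi> 0 ^ r * \<phi>') (n, r))) (at 0)"
  unfolding lagrange_sum_def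
proof (intro DERIV_sum)
  fix r
  have "((\<lambda>h. lookup (\<phi> h ^ Suc r) (n, r)) has_real_derivative
     lookup (of_nat (Suc r) * (\<phi> 0 ^ r * \<phi>')) (n, r)) (at 0)"
    using has_coeff_deriv_power[OF additive_weights(1) assms, of r] unfolding has_coeff_deriv_def
    by (auto simp: total_degree_def)
  also have "lookup (of_nat (Suc r) * (\<phi> 0 ^ r * \<phi>')) (n, r) =
      real (Suc r) * lookup (\<phi> 0 ^ r * \<phi>') (n, r)"
    by (simp only: single_of_nat[symmetric] lookup_const_mult)
  finally have "((\<lambda>h. lookup (\<phi> h ^ Suc r) (n, r)) has_real_derivative
     real (Suc r) * lookup (\<phi> 0 ^ r * \<phi>') (n, r)) (at 0)" .
  from DERIV_cdivide[OF this, of "real (Suc r)"]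
  show "((\<lambda>h. lookup (\<phi> h ^ Suc r) (n, r) / real (Suc r)) has_real_derivative
     lookup (\<phi> 0 ^ r * \<phi>') (n, r)) (at 0)"
    by (simp del: power_Suc of_nat_Suc)
qed

section \<open>The Lagrange sum as a sum over partitions\<close>

text \<open>The possible members of the partitions: the bound on the total degree makes this set finite, and
  \<open>implicit_partition_bounds\<close> shows that it excludes no partition.\<close>

definition admissible :: "nat \<Rightarrow> 'q::finite index set" where
  "admissible N = {u. u \<noteq> 0 \<and> u \<noteq> (0, 1) \<and> total_degree u \<le> N}"

lemma finite_admissible: "finite (admissible N)"
  by (rule finite_subset[OF _ finite_total_degree_le[of N]]) (auto simp: admissible_def)

lemma sum_mset_additive:
  fixes w :: "'m::finite_splits \<Rightarrow> nat"
  assumes "additive_weight w" shows "w (sum_mset p) = (\<Sum>u\<in>#p. w u)"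
proof (induction p)
  case empty
  have "w (0 + 0) = w 0 + w 0" using assms unfolding additive_weight_def by blast
  then show ?case by simp
next
  case (add u p)
  then show ?case using assms by (simp add: additive_weight_def)
qed

text \<open>Adding up the weights, each at least 2, bounds the number of parts. Adding up the total degrees,
  each at least 1, leaves at most \<open>mi_abs n\<close> for a single part.\<close>

lemma implicit_partition_bounds:
  fixes n :: "nat^'q::finite"
  assumes n: "n \<noteq> 0" and p: "p \<turnstile> (n, size p - 1)" "(0, 1) \<notin># p"
  shows "0 < size p" "size p < 2 * mi_abs n" "set_mset p \<subseteq> admissible (mi_abs n)"
proof -
  have sum: "sum_mset p = (n, size p - 1)" and "0 \<notin># p"
    using p by (auto simp: mi_partition_def)
  then have ge: "2 \<le> weight u" "1 \<le> total_degree u" if "u \<in># p" for u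
    using weight_less_2[of u] total_degree_eq_0_iff[of u] that p(2) by fastforce+
  show pos: "0 < size p" using sum n by (cases "p = {#}") (auto simp: zero_prod_def nonempty_has_size)
  have "(\<Sum>u\<in>#p. 2) \<le> (\<Sum>u\<in>#p. weight u)" using ge(1) by (intro sum_mset_mono) auto
  also have "\<dots> = 2 * mi_abs n + (size p - 1)"
    using sum_mset_additive[OF additive_weights(2), of p] by (simp add: sum weight_def)
  finally show "size p < 2 * mi_abs n" using pos by simp
  have "total_degree u \<le> mi_abs n" if u: "u \<in># p" for u
  proof -
    obtain p' where p': "p = add_mset u p'" using multi_member_split[OF u] by blast
    have "(\<Sum>u\<in>#p'. 1) \<le> (\<Sum>u\<in>#p'. total_degree u)" using ge(2) p' by (intro sum_mset_mono) auto
    moreover have "mi_abs n + (size p - 1) = total_degree u + (\<Sum>u\<in>#p'. total_degree u)"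
      using sum_mset_additive[OF additive_weights(1), of p]
      total_degree_def[of "sum_mset p"] by (simp only: sum) (simp add: p')
    ultimately show ?thesis by (simp add: p')
  qed
  then show "set_mset p \<subseteq> admissible (mi_abs n)"
    using p(2) \<open>0 \<notin># p\<close> by (auto simp: admissible_def)
qed

theorem lagrange_sum_eq_partition_sum:
  fixes a :: "'q::finite index \<Rightarrow> real"
  assumes n: "n \<noteq> 0" and N: "mi_abs n \<le> N" and R: "2 * mi_abs n \<le> R"
  shows "lagrange_sum R n (\<Sum>u\<in>admissible N. single u (a u)) =
    (\<Sum>p | p \<turnstile> (n, size p - 1) \<and> (0, 1) \<notin># p.
       1 / real (size p) * mset_multinomial p * (\<Prod>u\<in>#p. a u))"
proof -
  let ?P = "{p. p \<turnstile> (n, size p - 1) \<and> (0, 1) \<notin># p}"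
  let ?f = "\<lambda>p. 1 / real (size p) * mset_multinomial p * (\<Prod>u\<in>#p. a u)"
  let ?M = "\<lambda>r. {p. set_mset p \<subseteq> admissible N \<and> size p = Suc r \<and> sum_mset p = (n, r)}"
  have M: "{p\<in>?P. size p - 1 = r} = ?M r" if "r < R" for r
  proof (intro equalityI subsetI)
    fix p assume "p \<in> {p\<in>?P. size p - 1 = r}"
    moreover from this have "0 < size p" "set_mset p \<subseteq> admissible (mi_abs n)"
      using implicit_partition_bounds[OF n] by blast+
    ultimately show "p \<in> ?M r"
      using N by (auto simp: mi_partition_def admissible_def)
  qed (auto simp: mi_partition_def admissible_def)
  have "lagrange_sum R n (\<Sum>u\<in>admissible N. single u (a u)) = (\<Sum>r<R. \<Sum>p\<in>?M r. ?f p)"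
    unfolding lagrange_sum_def lookup_power_sum_single[OF finite_admissible] sum_divide_distrib
    by (intro sum.cong) auto
  also have "\<dots> = (\<Sum>r<R. \<Sum>p\<in>{p\<in>?P. size p - 1 = r}. ?f p)"
    by (rule sum.cong[OF refl]) (simp only: M lessThan_iff)
  also have "\<dots> = (\<Sum>p\<in>?P. ?f p)"
  proof (rule sum.group[OF finite_implicit_partitions finite_lessThan])
    show "(\<lambda>p. size p - 1) ` ?P \<subseteq> {..<R}"
      using implicit_partition_bounds(1,2)[OF n] R by fastforce
  qed
  finally show ?thesis .
qed

section \<open>Iterated partial derivatives\<close>

lemma partial_deriv_along_line:
  fixes x b :: "'a::real_normed_vector"
  assumes "(\<lambda>h. f (x + h0 *\<^sub>R b + h *\<^sub>R b)) differentiable at 0"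
  shows "((\<lambda>h. f (x + h *\<^sub>R b)) has_real_derivative partial_deriv b f (x + h0 *\<^sub>R b)) (at h0)"
proof -
  let ?F = "\<lambda>h. f (x + h0 *\<^sub>R b + h *\<^sub>R b)"
  have "(?F has_real_derivative partial_deriv b f (x + h0 *\<^sub>R b)) (at (h0 + - h0))"
    using assms by (simp add: partial_deriv_def DERIV_deriv_iff_real_differentiable)
  then have "((\<lambda>h. ?F (h + - h0)) has_real_derivative partial_deriv b f (x + h0 *\<^sub>R b)) (at h0)"
    by (subst (asm) DERIV_shift)
  moreover have "?F (h + - h0) = f (x + h *\<^sub>R b)" for h
    by (simp add: algebra_simps)
  ultimately show ?thesis by simp
qed

lemma eventually_line_in_open:
  fixes x b :: "'a::real_normed_vector"
  assumes "open S" "x \<in> S"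
  shows "\<forall>\<^sub>F h in nhds 0. x + h *\<^sub>R b \<in> S"
proof -
  have "((\<lambda>h. x + h *\<^sub>R b) \<longlongrightarrow> x + 0 *\<^sub>R b) (nhds 0)"
    by (intro tendsto_intros filterlim_ident)
  then show ?thesis
    using assms by (simp add: topological_tendstoD)
qed

lemma partial_deriv_cong:
  assumes "open S" "x \<in> S" "\<And>z. z \<in> S \<Longrightarrow> f z = g z"
  shows "partial_deriv b f x = partial_deriv b g x"
  unfolding partial_deriv_def
  by (intro deriv_cong_ev eventually_mono[OF eventually_line_in_open[OF assms(1,2), of b]] assms(3) refl)

lemma Ck_on_Suc_imp: "Ck_on (Suc k) f S \<Longrightarrow> Ck_on k f S"
proof (induction k arbitrary: f)
  case (Suc k)
  then show ?case by (auto simp only: Ck_on.simps)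
qed simp

lemma Ck_on_mono: "Ck_on k f S \<Longrightarrow> l \<le> k \<Longrightarrow> Ck_on l f S"
  by (induction k) (auto simp: le_Suc_eq simp del: Ck_on.simps dest: Ck_on_Suc_imp)

lemma Ck_on_has_partial:
  assumes "Ck_on (Suc k) f S" "b \<in> Basis" "x + h *\<^sub>R b \<in> S"
  shows "((\<lambda>h. f (x + h *\<^sub>R b)) has_real_derivative partial_deriv b f (x + h *\<^sub>R b)) (at h)"
  using assms by (intro partial_deriv_along_line) simp

text \<open>The mean value theorem, once in direction \<open>b\<close> and then in direction \<open>c\<close>. The left-hand side is
  symmetric in \<open>b\<close> and \<open>c\<close>, which is what yields the symmetry of second derivatives.\<close>

lemma second_difference_mean_value:
  fixes f :: "'a::euclidean_space \<Rightarrow> real"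
  assumes f: "Ck_on 2 f S" and b: "b \<in> Basis" and c: "c \<in> Basis" and h: "0 < h"
    and S: "\<And>u v. 0 \<le> u \<Longrightarrow> u \<le> h \<Longrightarrow> 0 \<le> v \<Longrightarrow> v \<le> h \<Longrightarrow> x + u *\<^sub>R b + v *\<^sub>R c \<in> S"
  shows "\<exists>u v. 0 < u \<and> u < h \<and> 0 < v \<and> v < h \<and>
    f (x + h *\<^sub>R b + h *\<^sub>R c) - f (x + h *\<^sub>R b) - f (x + h *\<^sub>R c) + f x =
      h * h * partial_deriv c (partial_deriv b f) (x + u *\<^sub>R b + v *\<^sub>R c)"
proof -
  have f1: "Ck_on (Suc 1) f S" and f2: "Ck_on (Suc 0) (partial_deriv b f) S"
    using f b by (simp_all add: numeral_2_eq_2)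
  let ?F = "\<lambda>u. f (x + h *\<^sub>R c + u *\<^sub>R b) - f (x + u *\<^sub>R b)"
  have "\<exists>u. 0 < u \<and> u < h \<and> ?F h - ?F 0 = (h - 0) *
      (partial_deriv b f (x + h *\<^sub>R c + u *\<^sub>R b) - partial_deriv b f (x + u *\<^sub>R b))"
  proof (rule MVT2[OF h])
    fix u :: real assume u: "0 \<le> u" "u \<le> h"
    have "x + h *\<^sub>R c + u *\<^sub>R b \<in> S" "x + u *\<^sub>R b \<in> S"
      using S[of u h] S[of u 0] u h by (simp_all add: add.commute add.left_commute)
    then show "(?F has_real_derivative
        partial_deriv b f (x + h *\<^sub>R c + u *\<^sub>R b) - partial_deriv b f (x + u *\<^sub>R b)) (at u)"
      by (intro DERIV_diff Ck_on_has_partial[OF f1 b])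
  qed
  then obtain u where u: "0 < u" "u < h" and F: "?F h - ?F 0 = h *
      (partial_deriv b f (x + h *\<^sub>R c + u *\<^sub>R b) - partial_deriv b f (x + u *\<^sub>R b))"
    by auto
  let ?G = "\<lambda>v. partial_deriv b f (x + u *\<^sub>R b + v *\<^sub>R c)"
  have "\<exists>v. 0 < v \<and> v < h \<and> ?G h - ?G 0 = (h - 0) *
      partial_deriv c (partial_deriv b f) (x + u *\<^sub>R b + v *\<^sub>R c)"
  proof (rule MVT2[OF h])
    fix v :: real assume v: "0 \<le> v" "v \<le> h"
    show "(?G has_real_derivative partial_deriv c (partial_deriv b f) (x + u *\<^sub>R b + v *\<^sub>R c)) (at v)"
      using S[of u v] u v by (intro Ck_on_has_partial[OF f2 c]) simp
  qed
  then obtain v where v: "0 < v" "v < h" and G: "?G h - ?G 0 =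
      h * partial_deriv c (partial_deriv b f) (x + u *\<^sub>R b + v *\<^sub>R c)"
    by auto
  have "f (x + h *\<^sub>R b + h *\<^sub>R c) - f (x + h *\<^sub>R b) - f (x + h *\<^sub>R c) + f x = ?F h - ?F 0"
    by (simp add: algebra_simps)
  also have "\<dots> = h * (?G h - ?G 0)"
    unfolding F by (simp add: add.commute add.left_commute)
  also have "\<dots> = h * h * partial_deriv c (partial_deriv b f) (x + u *\<^sub>R b + v *\<^sub>R c)"
    unfolding G by simp
  finally show ?thesis using u v by blast
qed

text \<open>Both mixed derivatives are the limit of the same second difference quotient.\<close>

lemma partial_deriv_commute:
  fixes f :: "'a::euclidean_space \<Rightarrow> real"
  assumes S: "open S" and f: "Ck_on 2 f S" and b: "b \<in> Basis" and c: "c \<in> Basis" and x: "x \<in> S"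
  shows "partial_deriv b (partial_deriv c f) x = partial_deriv c (partial_deriv b f) x"
proof -
  obtain e where e: "0 < e" "ball x e \<subseteq> S" using S x by (auto simp: open_contains_ball)
  define h where "h n = e / 4 / real (Suc n)" for n
  have h: "0 < h n" for n using e by (simp add: h_def)
  have h_le: "h n \<le> e / 4" for n
  proof -
    have "e / 4 / real (Suc n) \<le> e / 4 / 1" using e by (intro divide_left_mono) auto
    then show ?thesis by (simp only: h_def div_by_1)
  qed
  have h0: "h \<longlonglongrightarrow> 0"
    unfolding h_def by (rule LIMSEQ_Suc[OF lim_const_over_n])
  have box: "x + u *\<^sub>R b + v *\<^sub>R c \<in> S" if "b \<in> Basis" "c \<in> Basis"
    "0 \<le> u" "u \<le> h n" "0 \<le> v" "v \<le> h n" for u v n b c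
  proof -
    have "norm (u *\<^sub>R b + v *\<^sub>R c) \<le> u + v"
      using norm_triangle_ineq[of "u *\<^sub>R b" "v *\<^sub>R c"] that by simp
    also have "\<dots> \<le> h n + h n" using that by simp
    also have "\<dots> < e" using h_le[of n] e by linarith
    finally have "x + u *\<^sub>R b + v *\<^sub>R c \<in> ball x e"
      using dist_add_cancel[of x 0 "u *\<^sub>R b + v *\<^sub>R c"] by (simp add: add.assoc)
    then show ?thesis using e by blast
  qed
  have lim: "(\<lambda>n. (f (x + h n *\<^sub>R b + h n *\<^sub>R c) - f (x + h n *\<^sub>R b) - f (x + h n *\<^sub>R c) + f x) / (h n * h n))
      \<longlonglongrightarrow> partial_deriv c (partial_deriv b f) x" if b: "b \<in> Basis" and c: "c \<in> Basis" for b c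
  proof -
    have "\<forall>n. \<exists>u v. 0 < u \<and> u < h n \<and> 0 < v \<and> v < h n \<and>
      f (x + h n *\<^sub>R b + h n *\<^sub>R c) - f (x + h n *\<^sub>R b) - f (x + h n *\<^sub>R c) + f x =
        h n * h n * partial_deriv c (partial_deriv b f) (x + u *\<^sub>R b + v *\<^sub>R c)" (is "\<forall>n. ?Q n")
    proof
      fix n
      show "?Q n"
        by (rule second_difference_mean_value[OF f b c h]) (rule box[OF b c])
    qed
    then obtain u v where uv: "\<And>n. 0 < u n" "\<And>n. u n < h n" "\<And>n. 0 < v n" "\<And>n. v n < h n"
      and eq: "\<And>n. f (x + h n *\<^sub>R b + h n *\<^sub>R c) - f (x + h n *\<^sub>R b) - f (x + h n *\<^sub>R c) + f x =
        h n * h n * partial_deriv c (partial_deriv b f) (x + u n *\<^sub>R b + v n *\<^sub>R c)"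
      by metis
    have "u \<longlonglongrightarrow> 0" "v \<longlonglongrightarrow> 0"
      using uv by (auto intro!: tendsto_sandwich[OF _ _ tendsto_const h0] eventuallyI less_imp_le)
    then have "(\<lambda>n. x + u n *\<^sub>R b + v n *\<^sub>R c) \<longlonglongrightarrow> x + 0 *\<^sub>R b + 0 *\<^sub>R c"
      by (intro tendsto_intros)
    then have "(\<lambda>n. x + u n *\<^sub>R b + v n *\<^sub>R c) \<longlonglongrightarrow> x" by simp
    moreover have "isCont (partial_deriv c (partial_deriv b f)) x"
      using f b c S x by (simp add: numeral_2_eq_2 continuous_on_eq_continuous_at)
    ultimately have "(\<lambda>n. partial_deriv c (partial_deriv b f) (x + u n *\<^sub>R b + v n *\<^sub>R c))
        \<longlonglongrightarrow> partial_deriv c (partial_deriv b f) x"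
      by (rule isCont_tendsto_compose[rotated])
    moreover have "h n \<noteq> 0" for n using h[of n] by simp
    ultimately show ?thesis unfolding eq by simp
  qed
  have "(\<lambda>n. (f (x + h n *\<^sub>R c + h n *\<^sub>R b) - f (x + h n *\<^sub>R c) - f (x + h n *\<^sub>R b) + f x) / (h n * h n)) =
     (\<lambda>n. (f (x + h n *\<^sub>R b + h n *\<^sub>R c) - f (x + h n *\<^sub>R b) - f (x + h n *\<^sub>R c) + f x) / (h n * h n))"
    (is "?D = ?E")
  proof
    fix n
    have sw: "x + h n *\<^sub>R c + h n *\<^sub>R b = x + h n *\<^sub>R b + h n *\<^sub>R c" by (simp only: add_ac)
    have "f (x + h n *\<^sub>R c + h n *\<^sub>R b) - f (x + h n *\<^sub>R c) - f (x + h n *\<^sub>R b) + f x =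
        f (x + h n *\<^sub>R b + h n *\<^sub>R c) - f (x + h n *\<^sub>R b) - f (x + h n *\<^sub>R c) + f x"
      unfolding sw by linarith
    then show "?D n = ?E n" by simp
  qed
  then have "?D \<longlonglongrightarrow> partial_deriv c (partial_deriv b f) x" using lim[OF b c] by (simp only:)
  from LIMSEQ_unique[OF lim[OF c b] this] show ?thesis .
qed

text \<open>Differentiation along a list of directions makes the order of differentiation explicit, so that
  symmetry can be expressed as invariance under permutations of the list.\<close>

definition iter_deriv :: "'a::real_normed_vector list \<Rightarrow> ('a \<Rightarrow> real) \<Rightarrow> 'a \<Rightarrow> real" where
  "iter_deriv bs f = foldr partial_deriv bs f"

lemma iter_deriv_simps [simp]:
  "iter_deriv [] f = f" "iter_deriv (b # bs) f = partial_deriv b (iter_deriv bs f)"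
  "iter_deriv (bs @ cs) f = iter_deriv bs (iter_deriv cs f)"
  by (simp_all add: iter_deriv_def)

lemma Ck_on_iter_deriv:
  assumes "Ck_on (length bs + k) f S" "set bs \<subseteq> Basis"
  shows "Ck_on k (iter_deriv bs f) S"
  using assms
proof (induction bs arbitrary: k)
  case (Cons b bs)
  then have "Ck_on (Suc k) (iter_deriv bs f) S" by (simp del: Ck_on.simps)
  then show ?case using Cons.prems by simp
qed simp

lemma iter_deriv_move_front:
  assumes "open S" "Ck_on (Suc (length us + length vs)) f S" "set us \<subseteq> Basis" "set vs \<subseteq> Basis"
    "b \<in> Basis" "x \<in> S"
  shows "iter_deriv (us @ b # vs) f x = iter_deriv (b # us @ vs) f x"
  using assms(2,3,6)
proof (induction us arbitrary: x)
  case (Cons u us)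
  have C: "Ck_on 2 (iter_deriv (us @ vs) f) S"
    by (rule Ck_on_iter_deriv) (use Cons.prems assms in auto)
  have "iter_deriv ((u # us) @ b # vs) f x = partial_deriv u (iter_deriv (us @ b # vs) f) x"
    by simp
  also have "\<dots> = partial_deriv u (iter_deriv (b # us @ vs) f) x"
  proof (rule partial_deriv_cong[OF assms(1) Cons.prems(3)])
    show "iter_deriv (us @ b # vs) f z = iter_deriv (b # us @ vs) f z" if "z \<in> S" for z
    proof (rule Cons.IH[OF _ _ that])
      show "Ck_on (Suc (length us + length vs)) f S"
        by (rule Ck_on_mono[OF Cons.prems(1)]) simp
    qed (use Cons.prems in auto)
  qed
  also have "\<dots> = partial_deriv b (partial_deriv u (iter_deriv (us @ vs) f)) x"
    using partial_deriv_commute[OF assms(1) C _ assms(5) Cons.prems(3)] Cons.prems(2) by simp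
  finally show ?case by simp
qed simp

lemma iter_deriv_perm:
  assumes "open S" "Ck_on (length bs) f S" "set bs \<subseteq> Basis" "mset bs = mset cs" "x \<in> S"
  shows "iter_deriv bs f x = iter_deriv cs f x"
  using assms(2-5)
proof (induction bs arbitrary: cs x)
  case (Cons b bs)
  have "b \<in> set cs" using Cons.prems(3) by (metis list.set_intros(1) set_mset_mset)
  then obtain us vs where cs: "cs = us @ b # vs" by (meson split_list)
  have m: "mset bs = mset (us @ vs)" using Cons.prems(3) cs by simp
  have len: "length bs = length us + length vs" using mset_eq_length[OF m] by simp
  have set: "set bs = set us \<union> set vs" using mset_eq_setD[OF m] by simp
  have "iter_deriv (b # bs) f x = partial_deriv b (iter_deriv bs f) x" by simp
  also have "\<dots> = partial_deriv b (iter_deriv (us @ vs) f) x"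
  proof (rule partial_deriv_cong[OF assms(1) Cons.prems(4)])
    show "iter_deriv bs f z = iter_deriv (us @ vs) f z" if "z \<in> S" for z
    proof (rule Cons.IH[OF _ _ m that])
      show "Ck_on (length bs) f S"
        by (rule Ck_on_mono[OF Cons.prems(1)]) simp
    qed (use Cons.prems in auto)
  qed
  also have "\<dots> = iter_deriv cs f x"
    using iter_deriv_move_front[OF assms(1), of us vs f b x] Cons.prems set len cs by simp
  finally show ?case .
qed simp

definition dir_list :: "('q::finite \<Rightarrow> 'a) \<Rightarrow> nat^'q \<Rightarrow> 'a list" where
  "dir_list e n = concat (map (\<lambda>i. replicate (n $ i) (e i)) coords)"

lemma coords: "distinct (coords :: 'q::finite list)" "set (coords :: 'q list) = UNIV"
proof -
  have "\<exists>is. distinct is \<and> set is = (UNIV :: 'q set)"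
    using finite_distinct_list[of "UNIV :: 'q set"] by auto
  from someI_ex[OF this] show "distinct (coords :: 'q list)" "set (coords :: 'q list) = UNIV"
    by (simp_all add: coords_def)
qed

lemma funpow_partial_deriv: "(partial_deriv b ^^ k) f = iter_deriv (replicate k b) f"
  by (induction k) auto

lemma mixed_deriv_eq: "mixed_deriv e n f = iter_deriv (dir_list e n) f"
proof -
  have "foldr (\<lambda>i. partial_deriv (e i) ^^ (n $ i)) cs f =
      iter_deriv (concat (map (\<lambda>i. replicate (n $ i) (e i)) cs)) f" for cs
    by (induction cs) (auto simp: funpow_partial_deriv)
  then show ?thesis by (simp add: mixed_deriv_def dir_list_def)
qed

lemma mset_dir_list: "mset (dir_list e n) = (\<Sum>i\<in>UNIV. replicate_mset (n $ i) (e i))"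
  by (simp add: dir_list_def mset_concat comp_def sum_list_distinct_conv_sum_set[OF coords(1)] coords(2))

lemma mset_dir_list_axis: "mset (dir_list e (axis i 1 + n)) = add_mset (e i) (mset (dir_list e n))"
proof -
  have "replicate_mset ((axis i 1 + n) $ j) (e j) =
      (if i = j then {#e i#} else {#}) + replicate_mset (n $ j) (e j)" for j
    by (auto simp: axis_def)
  then show ?thesis unfolding mset_dir_list by (simp add: sum.distrib)
qed

lemma length_dir_list: "length (dir_list e n) = mi_abs n"
  by (simp add: dir_list_def length_concat comp_def sum_list_distinct_conv_sum_set[OF coords(1)] coords(2) mi_abs_def)

lemma set_dir_list: "set (dir_list e n) \<subseteq> range e"
  by (auto simp: dir_list_def)

lemma dir_list_0 [simp]: "dir_list e 0 = []"
  by (simp add: dir_list_def)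

lemma x_deriv_eq: "x_deriv n f = iter_deriv (dir_list (\<lambda>i. axis i 1) n) f"
  by (simp add: x_deriv_def mixed_deriv_eq)

lemma x_deriv_axis:
  assumes "open U" "Ck_on (Suc (mi_abs n)) y U" "x \<in> U"
  shows "x_deriv (axis i 1 + n) y x = partial_deriv (axis i 1) (x_deriv n y) x"
proof -
  have "iter_deriv (axis i 1 # dir_list (\<lambda>i. axis i 1) n) y x =
      iter_deriv (dir_list (\<lambda>i. axis i 1) (axis i 1 + n)) y x"
    by (rule iter_deriv_perm[OF assms(1) _ _ _ assms(3)])
       (use assms(2) set_dir_list[of "\<lambda>i. axis i 1" n] in
         \<open>auto simp: length_dir_list mset_dir_list_axis axis_in_Basis_iff simp del: Ck_on.simps One_nat_def\<close>)
  then show ?thesis by (simp add: x_deriv_eq)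
qed

abbreviation xy_dirs :: "nat^'q::finite \<Rightarrow> nat \<Rightarrow> ((real^'q) \<times> real) list" where
  "xy_dirs s t \<equiv> dir_list (\<lambda>i. (axis i 1, 0)) s @ replicate t (0, 1)"

lemma xy_deriv_eq: "xy_deriv s t g = iter_deriv (xy_dirs s t) g"
  by (simp add: xy_deriv_def mixed_deriv_eq funpow_partial_deriv)

lemma xy_basis: "(axis i 1, 0) \<in> (Basis :: ((real^'q::finite) \<times> real) set)"
  "(0, 1) \<in> (Basis :: ((real^'q) \<times> real) set)"
  by (auto simp: Basis_prod_def axis_in_Basis_iff)

lemma set_xy_dirs: "set (xy_dirs s t) \<subseteq> (Basis :: ((real^'q::finite) \<times> real) set)"
proof -
  have "range (\<lambda>i. (axis i 1, 0)) \<subseteq> (Basis :: ((real^'q) \<times> real) set)"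
    using xy_basis(1) by blast
  moreover have "set (replicate t (0, 1)) \<subseteq> (Basis :: ((real^'q) \<times> real) set)"
    using xy_basis(2)[where 'q = 'q] by (simp add: set_replicate_conv_if)
  ultimately show ?thesis
    unfolding set_append using set_dir_list by (meson Un_least subset_trans)
qed

lemma Ck_on_xy_deriv:
  assumes "Ck_on (mi_abs s + t + k) g W"
  shows "Ck_on k (xy_deriv s t g) W"
  unfolding xy_deriv_eq by (rule Ck_on_iter_deriv) (use assms set_xy_dirs in \<open>auto simp: length_dir_list\<close>)

lemma xy_deriv_axis:
  assumes "open W" "Ck_on (Suc (mi_abs s + t)) g W" "w \<in> W"
  shows "partial_deriv (axis i 1, 0) (xy_deriv s t g) w = xy_deriv (axis i 1 + s) t g w"
proof -
  have "iter_deriv ((axis i 1, 0) # xy_dirs s t) g w = iter_deriv (xy_dirs (axis i 1 + s) t) g w"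
    by (rule iter_deriv_perm[OF assms(1) _ _ _ assms(3)])
       (use assms(2) set_xy_dirs[of s t] xy_basis(1)[of i] in
         \<open>auto simp: length_dir_list mset_dir_list_axis simp del: Ck_on.simps One_nat_def\<close>)
  then show ?thesis by (simp add: xy_deriv_eq)
qed

lemma xy_deriv_Suc:
  fixes g :: "(real^'q::finite) \<times> real \<Rightarrow> real"
  assumes "open W" "Ck_on (Suc (mi_abs s + t)) g W" "w \<in> W"
  shows "partial_deriv (0, 1) (xy_deriv s t g) w = xy_deriv s (Suc t) g w"
proof -
  have "iter_deriv ((0, 1) # xy_dirs s t) g w = iter_deriv (xy_dirs s (Suc t)) g w"
    by (rule iter_deriv_perm[OF assms(1) _ _ _ assms(3)])
       (use assms(2) set_xy_dirs[of s t] xy_basis(2)[where 'q = 'q] in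
         \<open>auto simp: length_dir_list simp del: Ck_on.simps\<close>)
  then show ?thesis by (simp add: xy_deriv_eq)
qed

text \<open>A two-variable problem: $(h, z) \mapsto f(x + h e_i, z)$ is totally differentiable because its
  partial derivative in $z$ is continuous, and it is composed with $h \mapsto (h, y(x + h e_i))$.\<close>

lemma partial_chain_rule:
  fixes f :: "(real^'q::finite) \<times> real \<Rightarrow> real"
  assumes U: "open U" and V: "open V" "convex V" and yU: "y ` U \<subseteq> V" and x: "x \<in> U"
    and y: "((\<lambda>h. y (x + h *\<^sub>R axis i 1)) has_real_derivative y') (at 0)"
    and f: "Ck_on 1 f (U \<times> V)"
  shows "((\<lambda>h. f (x + h *\<^sub>R axis i 1, y (x + h *\<^sub>R axis i 1))) has_real_derivative
    partial_deriv (axis i 1, 0) f (x, y x) + partial_deriv (0, 1) f (x, y x) * y') (at 0)"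
proof -
  define L where "L h = x + h *\<^sub>R axis i (1::real)" for h
  define X where "X = L -` U"
  have L: "continuous_on UNIV L" unfolding L_def by (intro continuous_intros)
  have X: "open X" "0 \<in> X"
    using open_vimage[OF U L] x by (simp_all add: X_def L_def)
  have yx: "y x \<in> V" using yU x by auto
  have f1: "Ck_on (Suc 0) f (U \<times> V)" using f by simp
  have cont: "continuous_on (U \<times> V) (partial_deriv (0, 1) f)"
    using f1 xy_basis by auto
  define F where "F h z = f (L h, z)" for h z
  \<comment> \<open>The vertical derivative as a bounded linear map, because its continuity is stated for such maps.\<close>
  define Fz where "Fz h z = blinfun_scaleR_left (partial_deriv (0, 1) f (L h, z))" for h z
  have "((\<lambda>(h, z). F h z) has_derivative
      (\<lambda>(th, tz). partial_deriv (axis i 1, 0) f (x, y x) * th + blinfun_apply (Fz 0 (y x)) tz))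
      (at (0, y x) within X \<times> V)"
  proof (rule has_derivative_partialsI[OF _ _ _ yx V(2)])
    have "((\<lambda>h. f ((x, y x) + h *\<^sub>R (axis i 1, 0))) has_real_derivative
        partial_deriv (axis i 1, 0) f ((x, y x) + 0 *\<^sub>R (axis i 1, 0))) (at 0)"
      by (rule Ck_on_has_partial[OF f1 xy_basis(1)]) (use x yx in simp)
    then show "((\<lambda>h. F h (y x)) has_derivative (\<lambda>th. partial_deriv (axis i 1, 0) f (x, y x) * th))
        (at 0 within X)"
      by (simp add: F_def L_def has_field_derivative_def has_derivative_at_withinI)
  next
    fix h z assume h: "h \<in> X" "z \<in> V"
    have "((\<lambda>k. f ((L h, 0) + k *\<^sub>R (0, 1))) has_real_derivative
        partial_deriv (0, 1) f ((L h, 0) + z *\<^sub>R (0, 1))) (at z)"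
      by (rule Ck_on_has_partial[OF f1 xy_basis(2)]) (use h in \<open>simp add: X_def\<close>)
    then have "((\<lambda>z. F h z) has_derivative (*) (partial_deriv (0, 1) f (L h, z))) (at z within V)"
      by (simp add: F_def has_field_derivative_def has_derivative_at_withinI)
    moreover have "(*) (partial_deriv (0, 1) f (L h, z)) = blinfun_apply (Fz h z)"
      by (rule ext) (simp add: Fz_def)
    ultimately show "((\<lambda>z. F h z) has_derivative blinfun_apply (Fz h z)) (at z within V)"
      by simp
  next
    have "continuous_on (X \<times> V) (\<lambda>w. partial_deriv (0, 1) f (L (fst w), snd w))"
      by (rule continuous_on_compose2[OF cont])
         (auto intro!: continuous_intros continuous_on_compose2[OF L] simp: X_def)
    then have "continuous_on (X \<times> V) (\<lambda>(h, z). Fz h z)"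
      unfolding Fz_def case_prod_unfold
      by (intro bounded_linear.continuous_on[OF bounded_linear_blinfun_scaleR_left])
    then show "continuous (at (0, y x) within X \<times> V) (\<lambda>(h, z). Fz h z)"
      using X(2) yx by (auto simp: continuous_on_eq_continuous_within)
  qed
  then have F: "((\<lambda>(h, z). F h z) has_derivative
      (\<lambda>(th, tz). partial_deriv (axis i 1, 0) f (x, y x) * th + partial_deriv (0, 1) f (x, y x) * tz))
      (at (0, y (L 0)))"
    using X yx V(1) by (simp add: at_within_open[of _ "X \<times> V"] open_Times Fz_def L_def mult.commute)
  have "((\<lambda>h. (h, y (L h))) has_derivative (\<lambda>t. (t, y' * t))) (at 0)"
    using y by (intro has_derivative_Pair has_derivative_ident) (simp add: L_def has_field_derivative_def)
  from has_derivative_compose[OF this F]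
  have "((\<lambda>h. f (L h, y (L h))) has_derivative (\<lambda>t. partial_deriv (axis i 1, 0) f (x, y x) * t +
      partial_deriv (0, 1) f (x, y x) * (y' * t))) (at 0)"
    by (simp add: F_def)
  also have "(\<lambda>t. partial_deriv (axis i 1, 0) f (x, y x) * t +
      partial_deriv (0, 1) f (x, y x) * (y' * t)) =
      (*) (partial_deriv (axis i 1, 0) f (x, y x) + partial_deriv (0, 1) f (x, y x) * y')"
    by (rule ext) (simp add: algebra_simps)
  finally show ?thesis
    by (simp only: L_def has_field_derivative_def)
qed

section \<open>The implicit function and its Taylor coefficients\<close>

text \<open>The coefficients $a_{s,t}$ of the equation $z = \varphi(X, z)$ that arises by solving the Taylor
  expansion of $g$ for its linear term in $z$.\<close>

definition taylor_ratio :: "((real^'q) \<times> real \<Rightarrow> real) \<Rightarrow> (real^'q) \<times> real \<Rightarrow> 'q::finite index \<Rightarrow> real" where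
  "taylor_ratio g w = (\<lambda>(s, t). - (1 / (mi_fact s * fact t) * (xy_deriv s t g w / xy_deriv 0 1 g w)))"

definition implicit_series ::
  "nat \<Rightarrow> ((real^'q) \<times> real \<Rightarrow> real) \<Rightarrow> (real^'q) \<times> real \<Rightarrow> 'q::finite index \<Rightarrow>\<^sub>0 real" where
  "implicit_series N g w = (\<Sum>u\<in>admissible N. single u (taylor_ratio g w u))"

lemma lookup_implicit_series:
  "lookup (implicit_series N g w) u = (if u \<in> admissible N then taylor_ratio g w u else 0)"
  by (simp add: implicit_series_def lookup_sum lookup_single when_def finite_admissible)

lemma mi_fact_axis: "mi_fact (axis i 1 + n) = real (n $ i + 1) * mi_fact n"
proof -
  have "mi_fact (axis i 1 + n) = (\<Prod>j\<in>UNIV. (if j = i then real (n $ i + 1) else 1) * fact (n $ j))"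
    unfolding mi_fact_def by (intro prod.cong) (auto simp: axis_def)
  then show ?thesis by (simp add: prod.distrib mi_fact_def)
qed

lemma mi_fact_0 [simp]: "mi_fact 0 = 1"
  by (simp add: mi_fact_def)

lemma mi_fact_axis_1: "mi_fact (axis i 1) = 1"
  using mi_fact_axis[of i 0] by simp

lemma mi_fact_nonzero [simp]: "mi_fact n \<noteq> 0"
  by (simp add: mi_fact_def)

lemma axis_nonzero: "axis i (1::nat) \<noteq> 0" "axis i (1::nat) + s \<noteq> 0"
  using mi_abs_axis[of i] mi_abs_add[of "axis i 1" s] by (metis mi_abs_0 zero_neq_one, metis add_is_0 mi_abs_0 zero_neq_one)

text \<open>The order of smoothness \<open>N\<close> is fixed while the multi-index runs through all those of size at most
  \<open>N\<close>, as the induction requires.\<close>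

locale implicit_function =
  fixes U :: "(real^'q::finite) set" and V :: "real set"
    and y :: "real^'q \<Rightarrow> real" and g :: "(real^'q) \<times> real \<Rightarrow> real" and N :: nat
  assumes U: "open U" and V: "open V" "convex V" and y_V: "y ` U \<subseteq> V"
    and g_0: "\<And>x. x \<in> U \<Longrightarrow> g (x, y x) = 0"
    and g_y: "\<And>x. x \<in> U \<Longrightarrow> partial_deriv (0, 1) g (x, y x) \<noteq> 0"
    and N: "1 \<le> N" and y_C: "Ck_on N y U" and g_C: "Ck_on N g (U \<times> V)"
begin

abbreviation coef :: "'q index \<Rightarrow> real^'q \<Rightarrow> real" where
  "coef u x \<equiv> taylor_ratio g (x, y x) u"

lemma UV: "open (U \<times> V)"
  using U V by (intro open_Times)

lemma graph: "x \<in> U \<Longrightarrow> (x, y x) \<in> U \<times> V"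
  using y_V by auto

lemma xy_deriv_01: "xy_deriv 0 1 g = partial_deriv (0, 1) g"
  by (simp add: xy_deriv_eq)

text \<open>Implicit differentiation of $g(x, y(x)) = 0$.\<close>

lemma partial_y:
  assumes x: "x \<in> U"
  shows "((\<lambda>h. y (x + h *\<^sub>R axis i 1)) has_real_derivative coef (axis i 1, 0) x) (at 0)"
    and "partial_deriv (axis i 1) y x = coef (axis i 1, 0) x"
proof -
  have "Ck_on (Suc 0) y U" using Ck_on_mono[OF y_C, of 1] N by (simp del: Ck_on.simps)
  from Ck_on_has_partial[OF this, of "axis i 1" x 0] x
  have y: "((\<lambda>h. y (x + h *\<^sub>R axis i 1)) has_real_derivative partial_deriv (axis i 1) y x) (at 0)"
    by (simp add: axis_in_Basis_iff)
  have g1: "Ck_on 1 g (U \<times> V)" by (rule Ck_on_mono[OF g_C N])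
  have gi: "partial_deriv (axis i 1, 0) g (x, y x) = xy_deriv (axis i 1) 0 g (x, y x)"
    using xy_deriv_axis[OF UV _ graph[OF x], of 0 0 g i] g1 by (simp add: xy_deriv_eq)
  have ev: "\<forall>\<^sub>F h in nhds 0. g (x + h *\<^sub>R axis i 1, y (x + h *\<^sub>R axis i 1)) = 0"
    by (rule eventually_mono[OF eventually_line_in_open[OF U x]]) (rule g_0)
  have "((\<lambda>h. g (x + h *\<^sub>R axis i 1, y (x + h *\<^sub>R axis i 1))) has_real_derivative 0) (at 0)"
    by (simp only: DERIV_cong_ev[OF refl ev refl] DERIV_const)
  from DERIV_unique[OF this partial_chain_rule[OF U V y_V x y g1]]
  show *: "partial_deriv (axis i 1) y x = coef (axis i 1, 0) x"
    using g_y[OF x]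
    by (simp add: taylor_ratio_def gi[symmetric] xy_deriv_01 mi_fact_axis_1 field_simps del: One_nat_def)
  show "((\<lambda>h. y (x + h *\<^sub>R axis i 1)) has_real_derivative coef (axis i 1, 0) x) (at 0)"
    using y by (simp only: *)
qed

lemma xy_deriv_along_graph:
  assumes x: "x \<in> U" and st: "mi_abs s + t < N"
  shows "((\<lambda>h. xy_deriv s t g (x + h *\<^sub>R axis i 1, y (x + h *\<^sub>R axis i 1))) has_real_derivative
    xy_deriv (axis i 1 + s) t g (x, y x) + xy_deriv s (Suc t) g (x, y x) * coef (axis i 1, 0) x) (at 0)"
proof -
  have "Ck_on (Suc (mi_abs s + t)) g (U \<times> V)" by (rule Ck_on_mono[OF g_C]) (use st in simp)
  moreover from this have "Ck_on 1 (xy_deriv s t g) (U \<times> V)" by (intro Ck_on_xy_deriv) simp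
  ultimately show ?thesis
    using partial_chain_rule[OF U V y_V x partial_y(1)[OF x], of "xy_deriv s t g" i]
      xy_deriv_axis[OF UV _ graph[OF x], of s t g i] xy_deriv_Suc[OF UV _ graph[OF x], of s t g]
    by simp
qed

text \<open>The quotient rule. By the identities \<open>e3\<close> and \<open>e4\<close> of the proof, the logarithmic derivative of the
  denominator $g_{0,1}$ is $-\beta$.\<close>

lemma coef_has_deriv:
  assumes x: "x \<in> U" and st: "0 < mi_abs s + t" "mi_abs s + t < N"
  shows "((\<lambda>h. coef (s, t) (x + h *\<^sub>R axis i 1)) has_real_derivative
    real (s $ i + 1) * coef (axis i 1 + s, t) x + real (t + 1) * coef (s, t + 1) x * coef (axis i 1, 0) x
      + coef (s, t) x * (coef (axis i 1, 1) x + 2 * coef (0, 2) x * coef (axis i 1, 0) x)) (at 0)"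
proof -
  let ?w = "(x, y x)"
  define \<alpha> where "\<alpha> = coef (axis i 1, 0) x"
  define G where "G h = xy_deriv 0 1 g (x + h *\<^sub>R axis i 1, y (x + h *\<^sub>R axis i 1))" for h
  define C where "C h = xy_deriv s t g (x + h *\<^sub>R axis i 1, y (x + h *\<^sub>R axis i 1))" for h
  define k where "k = mi_fact s * fact t"
  have k: "k \<noteq> 0" by (simp add: k_def)
  have G0: "G 0 \<noteq> 0" using g_y[OF x] by (simp add: G_def xy_deriv_01 del: One_nat_def)
  have dG: "(G has_real_derivative xy_deriv (axis i 1) 1 g ?w + xy_deriv 0 2 g ?w * \<alpha>) (at 0)"
    using xy_deriv_along_graph[OF x, of 0 1 i] st unfolding G_def \<alpha>_def by (simp add: numeral_2_eq_2)
  have dC: "(C has_real_derivative xy_deriv (axis i 1 + s) t g ?w + xy_deriv s (Suc t) g ?w * \<alpha>) (at 0)"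
    using xy_deriv_along_graph[OF x st(2), of i] unfolding C_def \<alpha>_def .
  have e1: "xy_deriv (axis i 1 + s) t g ?w = - (real (s $ i + 1) * k * G 0 * coef (axis i 1 + s, t) x)"
    using G0 by (simp add: taylor_ratio_def G_def k_def mi_fact_axis del: One_nat_def)
  have e2: "xy_deriv s (Suc t) g ?w = - (real (t + 1) * k * G 0 * coef (s, t + 1) x)"
    using G0 by (simp add: taylor_ratio_def G_def k_def)
  have e3: "xy_deriv (axis i 1) 1 g ?w = - (G 0 * coef (axis i 1, 1) x)"
    using G0 by (simp add: taylor_ratio_def G_def mi_fact_axis_1 del: One_nat_def)
  have e4: "xy_deriv 0 2 g ?w = - (2 * G 0 * coef (0, 2) x)"
    using G0 by (simp add: taylor_ratio_def G_def)
  have e5: "C 0 = - (k * G 0 * coef (s, t) x)"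
    using G0 by (simp add: taylor_ratio_def G_def C_def k_def)
  have "((\<lambda>h. - (1 / k * (C h / G h))) has_real_derivative
      - (1 / k * (((xy_deriv (axis i 1 + s) t g ?w + xy_deriv s (Suc t) g ?w * \<alpha>) * G 0 -
        C 0 * (xy_deriv (axis i 1) 1 g ?w + xy_deriv 0 2 g ?w * \<alpha>)) / (G 0 * G 0)))) (at 0)"
    by (intro DERIV_minus DERIV_cmult DERIV_divide dC dG G0)
  also have "- (1 / k * (((xy_deriv (axis i 1 + s) t g ?w + xy_deriv s (Suc t) g ?w * \<alpha>) * G 0 -
        C 0 * (xy_deriv (axis i 1) 1 g ?w + xy_deriv 0 2 g ?w * \<alpha>)) / (G 0 * G 0))) =
      real (s $ i + 1) * coef (axis i 1 + s, t) x + real (t + 1) * coef (s, t + 1) x * \<alpha>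
      + coef (s, t) x * (coef (axis i 1, 1) x + 2 * coef (0, 2) x * \<alpha>)"
  proof -
    have "- (1 / k * ((- (a * k * G 0 * b) + - (a' * k * G 0 * b') * \<alpha>) * G 0 -
        - (k * G 0 * c) * (- (G 0 * d) + - (2 * G 0 * d') * \<alpha>)) / (G 0 * G 0)) =
        a * b + a' * b' * \<alpha> + c * (d + 2 * d' * \<alpha>)" for a b a' b' c d d'
      using k G0 by (simp add: field_simps)
    then show ?thesis unfolding e1 e2 e3 e4 e5 by simp
  qed
  finally have "((\<lambda>h. - (1 / k * (C h / G h))) has_real_derivative
      real (s $ i + 1) * coef (axis i 1 + s, t) x + real (t + 1) * coef (s, t + 1) x * \<alpha>
      + coef (s, t) x * (coef (axis i 1, 1) x + 2 * coef (0, 2) x * \<alpha>)) (at 0)" .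
  then show ?thesis
    by (simp add: taylor_ratio_def C_def G_def k_def \<alpha>_def)
qed

abbreviation series :: "real^'q \<Rightarrow> 'q index \<Rightarrow>\<^sub>0 real" where
  "series x \<equiv> implicit_series N g (x, y x)"

abbreviation beta :: "'q \<Rightarrow> real^'q \<Rightarrow> real" where
  "beta i x \<equiv> lookup (series x) (axis i 1, 1) + 2 * lookup (series x) (0, 2) * coef (axis i 1, 0) x"

lemma series_0: "lookup (series x) 0 = 0" "lookup (series x) (0, 1) = 0"
  by (simp_all add: lookup_implicit_series admissible_def)

lemma admissible_iff: "(s, t) \<in> admissible N \<longleftrightarrow> mi_abs s + t \<le> N \<and> (s \<noteq> 0 \<or> 2 \<le> t)"
  by (cases t; cases "t - 1") (auto simp: admissible_def total_degree_def zero_prod_def)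

lemma lookup_graph_derivative:
  "lookup (graph_derivative i \<alpha> \<beta> (series x)) (s, t) =
    real (s $ i + 1) * lookup (series x) (axis i 1 + s, t)
     + \<alpha> * (real (t + 1) * lookup (series x) (s, t + 1) - (if s = 0 \<and> t = 0 then 1 else 0))
     + \<beta> * (lookup (series x) (s, t) - (if s = 0 \<and> t = 1 then 1 else 0))"
  unfolding graph_derivative_def lookup_add lookup_const_mult lookup_minus lookup_poly_partial lookup_one lookup_single
  by (auto simp: when_def zero_prod_def axis_def)

text \<open>The coefficients of 1 and $z$ vanish identically, and the constants in \<open>graph_derivative\<close> are
  there to make its coefficients vanish in these two places. For the other exponents this is
  \<open>coef_has_deriv\<close>; the truncation does not interfere, because only exponents below the top
  degree \<open>N\<close> are concerned.\<close>

lemma series_has_coeff_deriv: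
  assumes x: "x \<in> U" and m: "m < N"
  shows "has_coeff_deriv total_degree (\<lambda>h. series (x + h *\<^sub>R axis i 1))
    (graph_derivative i (coef (axis i 1, 0) x) (beta i x) (series x)) 1 m"
proof -
  have at0: "lookup (graph_derivative i (coef (axis i 1, 0) x) (beta i x) (series x)) (0, 0) = 0"
    using N axis_nonzero[of i] mi_abs_axis[of i]
    by (simp add: lookup_graph_derivative lookup_implicit_series admissible_iff)
  have "((\<lambda>h. lookup (series (x + h *\<^sub>R axis i 1)) u) has_real_derivative
      lookup (graph_derivative i (coef (axis i 1, 0) x) (beta i x) (series x)) u) (at 0)"
    if u: "total_degree u < 1 + m" for u
  proof -
    obtain s t where st: "u = (s, t)" by (cases u)
    consider "s = 0" "t = 0" | "s = 0" "t = 1" | "s \<noteq> 0 \<or> 2 \<le> t" by linarith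
    then show ?thesis
    proof cases
      case 1
      then show ?thesis using at0 series_0 by (simp add: st zero_prod_def)
    next
      case 2
      have "lookup (graph_derivative i (coef (axis i 1, 0) x) (beta i x) (series x)) (0, 1) = 0"
        by (simp add: lookup_graph_derivative series_0[simplified] numeral_2_eq_2)
      then show ?thesis using 2 series_0 by (simp add: st)
    next
      case 3
      have ord: "mi_abs s + t < N" using u m by (simp add: st total_degree_def)
      have pos: "0 < mi_abs s + t" using 3 mi_abs_eq_0_iff[of s] by auto
      have mem: "(s, t) \<in> admissible N" "(axis i 1 + s, t) \<in> admissible N" "(s, t + 1) \<in> admissible N"
        "(axis i 1, 1) \<in> admissible N" "(0, 2) \<in> admissible N"
        using ord pos 3 axis_nonzero[of i] mi_abs_axis[of i]
        by (auto simp: admissible_iff mi_abs_add simp del: One_nat_def)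
      have "lookup (graph_derivative i (coef (axis i 1, 0) x) (beta i x) (series x)) (s, t) =
        real (s $ i + 1) * coef (axis i 1 + s, t) x + real (t + 1) * coef (s, t + 1) x * coef (axis i 1, 0) x
         + coef (s, t) x * (coef (axis i 1, 1) x + 2 * coef (0, 2) x * coef (axis i 1, 0) x)"
        unfolding lookup_graph_derivative lookup_implicit_series using mem 3 by auto
      then show ?thesis
        using coef_has_deriv[OF x pos ord, of i] mem(1) by (simp add: st lookup_implicit_series)
    qed
  qed
  moreover have "lookup (series z) u = 0"
    "lookup (graph_derivative i (coef (axis i 1, 0) x) (beta i x) (series x)) u = 0" if "total_degree u < 1" for z u
  proof -
    have "u = (0, 0)" using total_degree_eq_0_iff[of u] that by (simp add: zero_prod_def)
    then show "lookup (series z) u = 0"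
      "lookup (graph_derivative i (coef (axis i 1, 0) x) (beta i x) (series x)) u = 0"
      using at0 series_0(1)[of z] by (simp_all add: zero_prod_def)
  qed
  ultimately show ?thesis
    unfolding has_coeff_deriv_def by blast
qed

lemma lagrange_sum_series_has_deriv:
  assumes x: "x \<in> U" and m: "mi_abs m < N" and R: "2 * N \<le> R"
  shows "((\<lambda>h. lagrange_sum R m (series (x + h *\<^sub>R axis i 1))) has_real_derivative
    real (m $ i + 1) * lagrange_sum R (axis i 1 + m) (series x)
      - (if m = 0 then coef (axis i 1, 0) x else 0)) (at 0)"
proof -
  have R': "2 * mi_abs m < R" using m R by simp
  show ?thesis
    using lagrange_sum_has_deriv[OF series_has_coeff_deriv[OF x m, of i], of R]
    by (simp only: lagrange_sum_graph_derivative[OF series_0 R'] scaleR_zero_left add_0_right)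
qed

text \<open>The weight of the exponent $(0, r)$ is too small for a power of order $r + 1$.\<close>

lemma lagrange_sum_0: "lagrange_sum R 0 (series x) = 0"
proof -
  have "lookup (series x ^ Suc r) (0, r) = 0" for r
  proof (rule lookup_power_eq_0[OF additive_weights(2), of 2])
    show "lookup (series x) u = 0" if "weight u < 2" for u
      using weight_less_2[OF that] series_0 by auto
  qed (simp add: weight_def)
  then show ?thesis by (simp add: lagrange_sum_def del: power_Suc)
qed

text \<open>Induction on \<open>mi_abs n\<close>: differentiating the formula for $m$ at all points of \<open>U\<close> in direction \<open>i\<close>
  gives the formula for $m + e_i$. For $m = 0$ the Lagrange sum is 0 rather than $y(x)$, but then the
  surplus $-\alpha$ in its derivative produces the right starting value.\<close>

theorem x_deriv_eq_lagrange_sum: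
  assumes "n \<noteq> 0" "mi_abs n \<le> N" "x \<in> U" and R: "2 * N \<le> R"
  shows "x_deriv n y x / mi_fact n = lagrange_sum R n (series x)"
  using assms(1-3)
proof (induction "mi_abs n" arbitrary: n x rule: less_induct)
  case less
  obtain i where "n $ i \<noteq> 0" using less.prems(1) by (auto simp: vec_eq_iff)
  then obtain m where n: "n = axis i 1 + m" using axis_add_cases by blast
  then have m: "mi_abs m < N" "mi_abs m < mi_abs n"
    using less.prems(2) mi_abs_axis[of i] by (auto simp: mi_abs_add simp del: One_nat_def)
  have "Ck_on (Suc (mi_abs m)) y U" by (rule Ck_on_mono[OF y_C]) (use m in simp)
  then have D: "x_deriv n y x = partial_deriv (axis i 1) (x_deriv m y) x"
    unfolding n by (rule x_deriv_axis[OF U _ less.prems(3)])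
  note deriv = lagrange_sum_series_has_deriv[OF less.prems(3) m(1) R, of i]
  show ?case
  proof (cases "m = 0")
    case True
    have "((\<lambda>h. lagrange_sum R m (series (x + h *\<^sub>R axis i 1))) has_real_derivative 0) (at 0)"
      by (simp add: True lagrange_sum_0)
    from DERIV_unique[OF this deriv] True
    have "lagrange_sum R n (series x) = coef (axis i 1, 0) x" by (simp add: n)
    moreover have "x_deriv n y x = coef (axis i 1, 0) x"
      using D partial_y(2)[OF less.prems(3)] True by (simp add: x_deriv_eq)
    ultimately show ?thesis using mi_fact_axis[of i 0] by (simp add: n True)
  next
    case False
    have "x_deriv m y z = mi_fact m * lagrange_sum R m (series z)" if "z \<in> U" for z
      using less.hyps[OF m(2) False _ that] m(1) by (simp add: field_simps)
    then have "x_deriv n y x = partial_deriv (axis i 1) (\<lambda>z. mi_fact m * lagrange_sum R m (series z)) x"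
      unfolding D by (rule partial_deriv_cong[OF U less.prems(3)])
    also have "\<dots> = mi_fact m * (real (m $ i + 1) * lagrange_sum R n (series x))"
      unfolding partial_deriv_def using DERIV_imp_deriv[OF DERIV_cmult[OF deriv, of "mi_fact m"]] False
      by (simp add: n)
    also have "\<dots> = mi_fact n * lagrange_sum R n (series x)"
      by (simp only: n mi_fact_axis mult.commute mult.left_commute)
    finally show ?thesis by simp
  qed
qed

end

theorem corollary7:
  fixes U :: "(real^'q) set" and V :: "real set"
    and y :: "real^'q \<Rightarrow> real" and g :: "(real^'q) \<times> real \<Rightarrow> real"
    and n :: "nat^'q" and x :: "real^'q"
  assumes "open U" and "is_interval U"
    and "open V" and "is_interval V"
    and "y ` U \<subseteq> V"
    and "\<And>x. x \<in> U \<Longrightarrow> g (x, y x) = 0"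
    and "\<And>x. x \<in> U \<Longrightarrow> partial_deriv (0, 1) g (x, y x) \<noteq> 0"
    and "n \<noteq> 0"
    and "Ck_on (mi_abs n) y U"
    and "Ck_on (mi_abs n) g (U \<times> V)"
    and "x \<in> U"
  shows "x_deriv n y x / mi_fact n =
    (\<Sum>p | p \<turnstile> (n, size p - 1) \<and> (0, 1) \<notin># p.
       1 / real (size p) * mset_multinomial p *
       (\<Prod>(s, t)\<in>#p. - (1 / (mi_fact s * fact t) *
          (xy_deriv s t g (x, y x) / xy_deriv 0 1 g (x, y x)))))"
proof -
  interpret implicit_function U V y g "mi_abs n"
    using assms mi_abs_eq_0_iff[of n] by unfold_locales (auto simp: is_interval_convex)
  have "x_deriv n y x / mi_fact n = lagrange_sum (2 * mi_abs n) n (series x)"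
    by (rule x_deriv_eq_lagrange_sum) (use assms in auto)
  also have "\<dots> = (\<Sum>p | p \<turnstile> (n, size p - 1) \<and> (0, 1) \<notin># p.
       1 / real (size p) * mset_multinomial p * (\<Prod>u\<in>#p. coef u x))"
    unfolding implicit_series_def
    by (rule lagrange_sum_eq_partition_sum[OF assms(8)]) auto
  finally show ?thesis unfolding taylor_ratio_def .
qed

end
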